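(* There exist constants $c,C>0$ such that the following holds for all $n$ (a multiple of $4$). Let $T=cn^3$, let $|\psi_t\rangle=e^{-iH_{\rm XY}t}|0^n1^n\rangle$, and let $N(z)=\sum_{j=1}^n z_j$. Then $$\frac1T\int_0^T\sum_{z:\,N(z)>n/4}|\langle z|\psi_t\rangle|^2\,dt\;\ge\;\frac14-\frac{C}{\sqrt n}.$$
   Context: $H_{\rm XY}=-\frac12\sum_{w=1}^{2n-1}(X_wX_{w+1}+Y_wY_{w+1})$ acts on $(\mathbb C^2)^{\otimes 2n}$ with computational basis $|z\rangle$, $z\in\{0,1\}^{2n}$ ($X,Y$ Pauli matrices). The left-hand side is the probability of the event $N(z)>n/4$ when $t$ is chosen uniformly in $[0,T]$ and $z$ is obtained by measuring $|\psi_t\rangle$ in the computational basis. (In the paper's circuit-simulation scheme with time-independent Hamiltonian $\sum_pH^p_{\rm prop}$ and initial state $|0^{2n},0^n1^n\rangle_V$, the string register evolves exactly as $|\psi_t\rangle$, and the event $N(z)>n/4$ guarantees that all particles lie outside the $\frac n4\times\frac n4$ interaction region at the left corner of the grid.) *)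

theory Defs
  imports "HOL-Analysis.Analysis" "Jordan_Normal_Form.Matrix"
begin

definition kron :: "complex mat \<Rightarrow> complex mat \<Rightarrow> complex mat" where
  "kron A B = mat (dim_row A * dim_row B) (dim_col A * dim_col B)
     (\<lambda>(i,j). A $$ (i div dim_row B, j div dim_col B) * B $$ (i mod dim_row B, j mod dim_col B))"

definition pauliX :: "complex mat" where
  "pauliX = mat_of_rows_list 2 [[0, 1], [1, 0]]"

definition pauliY :: "complex mat" where
  "pauliY = mat_of_rows_list 2 [[0, -\<i>], [\<i>, 0]]"

(* single-qubit operator P acting on qubit w (1 \<le> w \<le> L) of an L-qubit register;
   qubit 1 is the most significant tensor factor *)
definition site_op :: "nat \<Rightarrow> nat \<Rightarrow> complex mat \<Rightarrow> complex mat" where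
  "site_op L w P = kron (kron (1\<^sub>m (2 ^ (w - 1))) P) (1\<^sub>m (2 ^ (L - w)))"

definition H_XY :: "nat \<Rightarrow> complex mat" where
  "H_XY L = mat (2 ^ L) (2 ^ L) (\<lambda>(i,j). - (1/2) *
     (\<Sum>w\<in>{1..<L}. (site_op L w pauliX * site_op L (w+1) pauliX
                    + site_op L w pauliY * site_op L (w+1) pauliY) $$ (i,j)))"

definition mat_exp :: "complex mat \<Rightarrow> complex mat" where
  "mat_exp A = mat (dim_row A) (dim_col A) (\<lambda>(i,j). \<Sum>k. (A ^\<^sub>m k) $$ (i,j) / of_nat (fact k))"

(* computational basis: index z < 2^L, bit z_w (w = 1..L) = (z div 2^(L-w)) mod 2 *)
definition zbit :: "nat \<Rightarrow> nat \<Rightarrow> nat \<Rightarrow> nat" where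
  "zbit L z w = (z div 2 ^ (L - w)) mod 2"

definition basis_index :: "nat \<Rightarrow> (nat \<Rightarrow> nat) \<Rightarrow> nat" where
  "basis_index L f = (\<Sum>w\<in>{1..L}. f w * 2 ^ (L - w))"

definition init_state :: "nat \<Rightarrow> complex vec" where
  "init_state n = unit_vec (2 ^ (2*n)) (basis_index (2*n) (\<lambda>w. if w \<le> n then 0 else 1))"

definition psi :: "nat \<Rightarrow> real \<Rightarrow> complex vec" where
  "psi n t = mat_exp ((- \<i> * complex_of_real t) \<cdot>\<^sub>m H_XY (2*n)) *\<^sub>v init_state n"

definition Ncount :: "nat \<Rightarrow> nat \<Rightarrow> nat" where
  "Ncount n z = (\<Sum>j\<in>{1..n}. zbit (2*n) z j)"

definition prob_event :: "nat \<Rightarrow> real \<Rightarrow> real" where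
  "prob_event n t = (\<Sum>z\<in>{z. z < 2 ^ (2*n) \<and> real (Ncount n z) > real n / 4}. (cmod (psi n t $ z))\<^sup>2)"

end

theory Submission
  imports Defs
begin

text \<open>
Under the Jordan--Wigner transformation the chain becomes free fermions hopping on a path with
\<open>L = 2n\<close> sites, with single-particle eigenvectors \<open>\<phi>\<^sub>k\<close> (sine modes) and eigenvalues \<open>-\<mu>\<^sub>k\<close>,
\<open>\<mu>\<^sub>k = 2 cos (k \<pi> / (L + 1))\<close>. If \<open>\<eta>\<^sub>k\<close> annihilates mode \<open>k\<close>, then \<open>[H, \<eta>\<^sub>k] = \<mu>\<^sub>k \<eta>\<^sub>k\<close>, so each
\<open>\<langle>\<eta>\<^sub>k \<psi>\<^sub>t, \<eta>\<^sub>l \<psi>\<^sub>t\<rangle>\<close> just rotates with frequency \<open>\<mu>\<^sub>l - \<mu>\<^sub>k\<close>. Writing \<open>A\<^sub>k\<^sub>l\<close> for the overlap of \<open>\<phi>\<^sub>k\<close> and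
\<open>\<phi>\<^sub>l\<close> on the initially empty half, the mean particle number there is
\<open>\<Sum>\<^sub>k\<^sub>l A\<^sub>k\<^sub>l (\<delta>\<^sub>k\<^sub>l - A\<^sub>k\<^sub>l) cos ((\<mu>\<^sub>l - \<mu>\<^sub>k) t)\<close>. By reflection symmetry \<open>A\<^sub>k\<^sub>k = 1/2\<close>, so the diagonal contributes
\<open>n/2\<close>; as \<open>\<Sum>\<^sub>k\<^sub>l A\<^sub>k\<^sub>l\<^sup>2 = n\<close> and the spectral gaps are at least \<open>4 / (2n + 1)\<^sup>2\<close>, the off-diagonal part
of the average over \<open>[0, T]\<close> is at most \<open>n (2n + 1)\<^sup>2 / (4 T)\<close>. Since the count is at most \<open>n\<close>, Markov's
inequality turns a mean close to \<open>n/2\<close> into probability close to \<open>1/3\<close> for exceeding \<open>n/4\<close>.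
\<close>

section \<open>The XY Hamiltonian on bit configurations\<close>

text \<open>Chain sites are numbered by bit position: qubit \<open>w\<close> is site \<open>L - w\<close>, so the left half of the
register is the set of sites \<open>{n..<2n}\<close>. A basis state is identified with its set of occupied sites.\<close>

lemma mem_set_decode_iff_bit: "m \<in> set_decode z \<longleftrightarrow> bit z m"
  by (simp add: set_decode_def bit_iff_odd)

lemma set_decode_less_power:
  assumes "z < 2 ^ L"
  shows "set_decode z \<subseteq> {..<L}"
proof
  fix m assume "m \<in> set_decode z"
  then have "z div 2 ^ m \<noteq> 0" by (auto simp: set_decode_def intro: odd_pos)
  then have "(2::nat) ^ m \<le> z" by (simp add: div_eq_0_iff not_less)
  then have "(2::nat) ^ m < 2 ^ L" using assms by (rule le_less_trans)
  then show "m \<in> {..<L}" by simp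
qed

lemma set_encode_less_power:
  assumes "S \<subseteq> {..<L}"
  shows "set_encode S < 2 ^ L"
proof -
  have "set_encode S \<le> (\<Sum>i<L. 2 ^ i)"
    unfolding set_encode_def using assms by (intro sum_mono2) auto
  also have "\<dots> < (2::nat) ^ L" by (induction L) auto
  finally show ?thesis .
qed

lemma bij_betw_set_decode: "bij_betw set_decode {..<2 ^ L} (Pow {..<L})"
proof (rule bij_betwI[of _ _ _ set_encode])
  show "set_decode \<in> {..<2 ^ L} \<rightarrow> Pow {..<L}"
    using set_decode_less_power by fastforce
  show "set_encode \<in> Pow {..<L} \<rightarrow> {..<2 ^ L}"
    using set_encode_less_power by auto
  show "set_decode (set_encode S) = S" if "S \<in> Pow {..<L}" for S
    using that finite_subset[of S "{..<L}"] by simp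
qed simp

section \<open>Matrix entries of one-site and two-site Pauli operators\<close>

text \<open>The three Kronecker factors see the bits above \<open>m\<close>, bit \<open>m\<close>
  itself and the bits below \<open>m\<close>. The two identity factors force agreement everywhere
  except at \<open>m\<close>, which for occupied sets means equality after deleting
  \<open>m\<close>.\<close>

lemma site_op_entry:
  assumes "1 \<le> w" "w \<le> L" "P \<in> carrier_mat 2 2" "i < 2 ^ L" "j < 2 ^ L" and m: "L - w = m"
  shows "site_op L w P $$ (i, j) =
    (if set_decode i - {m} = set_decode j - {m}
     then P $$ (of_bool (m \<in> set_decode i), of_bool (m \<in> set_decode j)) else 0)"
proof -
  have "w - 1 + 1 + m = L" using assms by simp
  then have p: "(2::nat) ^ (w - 1) * 2 * 2 ^ m = 2 ^ L"
    by (metis power_add power_one_right)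
  have b: "x div 2 ^ m < 2 ^ (w - 1) * 2" "x div 2 ^ m div 2 < 2 ^ (w - 1)" if "x < 2 ^ L" for x :: nat
    using that p by (simp_all add: less_mult_imp_div_less mult_ac)
  have bits: "x div 2 ^ m div 2 = y div 2 ^ m div 2 \<and> x mod 2 ^ m = y mod 2 ^ m \<longleftrightarrow>
      set_decode x - {m} = set_decode y - {m}" for x y :: nat
  proof -
    have "x div 2 ^ m div 2 = y div 2 ^ m div 2 \<longleftrightarrow> drop_bit (Suc m) x = drop_bit (Suc m) y"
      by (simp add: drop_bit_eq_div power_Suc2 div_mult2_eq del: power_Suc)
    also have "\<dots> \<longleftrightarrow> (\<forall>r. r > m \<longrightarrow> bit x r = bit y r)"
      by (auto simp: bit_eq_iff bit_drop_bit_eq) (metis less_iff_Suc_add)+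
    moreover have "x mod 2 ^ m = y mod 2 ^ m \<longleftrightarrow> take_bit m x = take_bit m y"
      by (simp add: take_bit_eq_mod)
    moreover have "\<dots> \<longleftrightarrow> (\<forall>r. r < m \<longrightarrow> bit x r = bit y r)"
      by (auto simp: bit_eq_iff bit_take_bit_iff)
    moreover have "set_decode x - {m} = set_decode y - {m} \<longleftrightarrow> (\<forall>r. r \<noteq> m \<longrightarrow> bit x r = bit y r)"
      by (auto simp: set_eq_iff mem_set_decode_iff_bit)
    ultimately show ?thesis by (metis nat_neq_iff)
  qed
  have mod2: "x div 2 ^ m mod 2 = of_bool (m \<in> set_decode x)" for x :: nat
    by (simp add: set_decode_def mod_2_eq_odd)
  have "site_op L w P $$ (i, j) =
      of_bool (i div 2 ^ m div 2 = j div 2 ^ m div 2) * P $$ (i div 2 ^ m mod 2, j div 2 ^ m mod 2) *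
      of_bool (i mod 2 ^ m = j mod 2 ^ m)"
    unfolding site_op_def kron_def m using assms(3-5) b p by (simp add: mult_ac)
  then show ?thesis
    unfolding mod2 using bits[of i j] by auto
qed

lemma site_op_carrier:
  assumes "1 \<le> w" "w \<le> L" "P \<in> carrier_mat 2 2"
  shows "site_op L w P \<in> carrier_mat (2 ^ L) (2 ^ L)"
proof -
  have "w - 1 + 1 + (L - w) = L" using assms by simp
  then have "(2::nat) ^ (w - 1) * 2 * 2 ^ (L - w) = 2 ^ L"
    by (metis power_add power_one_right)
  then show ?thesis using assms(3) by (auto simp: site_op_def kron_def)
qed

lemma adjacent_site_ops_entry:
  assumes "1 \<le> w" "w < L" "P \<in> carrier_mat 2 2" "Q \<in> carrier_mat 2 2" "i < 2 ^ L" "j < 2 ^ L"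
    and m: "L - w = Suc m"
  shows "(site_op L w P * site_op L (w + 1) Q) $$ (i, j) =
    (if set_decode i - {m, Suc m} = set_decode j - {m, Suc m}
     then P $$ (of_bool (Suc m \<in> set_decode i), of_bool (Suc m \<in> set_decode j)) *
          Q $$ (of_bool (m \<in> set_decode i), of_bool (m \<in> set_decode j)) else 0)"
proof -
  have m': "L - (w + 1) = m" using m by simp
  \<comment> \<open>The left factor can alter only site \<open>Suc m\<close> and the right one only
    site \<open>m\<close>, so a single intermediate configuration survives in the matrix product: it
    takes \<open>Suc m\<close> from \<open>j\<close> and every other site from
    \<open>i\<close>.\<close>
  define K where "K = (set_decode i - {Suc m}) \<union> (set_decode j \<inter> {Suc m})"
  have K: "K \<subseteq> {..<L}" "finite K"
    using set_decode_less_power[OF assms(5)] set_decode_less_power[OF assms(6)]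
    by (auto simp: K_def)
  define a where "a k = site_op L w P $$ (i, k) * site_op L (w + 1) Q $$ (k, j)" for k
  have a: "a k = (if set_decode i - {Suc m} = set_decode k - {Suc m} \<and> set_decode k - {m} = set_decode j - {m}
      then P $$ (of_bool (Suc m \<in> set_decode i), of_bool (Suc m \<in> set_decode k)) *
           Q $$ (of_bool (m \<in> set_decode k), of_bool (m \<in> set_decode j)) else 0)" if "k < 2 ^ L" for k
    using that assms(1-6) site_op_entry[OF _ _ _ _ _ m, of P i k] site_op_entry[OF _ _ _ _ _ m', of Q k j]
    by (simp add: a_def)
  have "(site_op L w P * site_op L (w + 1) Q) $$ (i, j) = (\<Sum>k<2 ^ L. a k)"
    using site_op_carrier[of w L P] site_op_carrier[of "w + 1" L Q] assms
    by (simp add: scalar_prod_def a_def lessThan_atLeast0)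
  also have "\<dots> = (\<Sum>k\<in>{set_encode K}. a k)"
  proof (rule sum.mono_neutral_right)
    show "{set_encode K} \<subseteq> {..<2 ^ L}" using set_encode_less_power[OF K(1)] by simp
    show "\<forall>k\<in>{..<2 ^ L} - {set_encode K}. a k = 0"
    proof
      fix k assume k: "k \<in> {..<2 ^ L} - {set_encode K}"
      then have "set_decode k \<noteq> K" by (metis DiffE insertI1 set_decode_inverse)
      then have "\<not> (set_decode i - {Suc m} = set_decode k - {Suc m} \<and> set_decode k - {m} = set_decode j - {m})"
        unfolding K_def by (metis (no_types, lifting) Int_insert_right_if0 Int_insert_right_if1 Int_empty_right
          Un_Diff_Int insert_Diff1 DiffI DiffD1 n_not_Suc_n singletonD)
      then show "a k = 0" using a k by auto
    qed
  qed simp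
  also have "\<dots> = a (set_encode K)" by simp
  also have "\<dots> = (if set_decode i - {m, Suc m} = set_decode j - {m, Suc m}
     then P $$ (of_bool (Suc m \<in> set_decode i), of_bool (Suc m \<in> set_decode j)) *
          Q $$ (of_bool (m \<in> set_decode i), of_bool (m \<in> set_decode j)) else 0)"
  proof -
    have "set_decode i - {Suc m} = K - {Suc m}" "Suc m \<in> K \<longleftrightarrow> Suc m \<in> set_decode j"
      "m \<in> K \<longleftrightarrow> m \<in> set_decode i" by (auto simp: K_def)
    moreover have "K - {m} = set_decode j - {m} \<longleftrightarrow> set_decode i - {m, Suc m} = set_decode j - {m, Suc m}"
      by (auto simp: K_def set_eq_iff)
    ultimately show ?thesis
      using a[OF set_encode_less_power[OF K(1)]] K(2) by simp
  qed
  finally show ?thesis .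
qed

lemma pauli_carrier: "pauliX \<in> carrier_mat 2 2" "pauliY \<in> carrier_mat 2 2"
  by (auto simp: pauliX_def pauliY_def mat_of_rows_list_def)

lemma pauliX_entry: "pauliX $$ (of_bool a, of_bool b) = of_bool (a \<noteq> b)"
  by (cases a; cases b) (simp_all add: pauliX_def mat_of_rows_list_def)

lemma pauliY_entry: "pauliY $$ (of_bool a, of_bool b) = (if a = b then 0 else if a then \<i> else - \<i>)"
  by (cases a; cases b) (simp_all add: pauliY_def mat_of_rows_list_def)

text \<open>For a double flip of equally occupied sites the XX entry 1 and the YY entry -1 cancel;
  for oppositely occupied sites both are 1. The resulting 2 later absorbs the prefactor 1/2 of the
  Hamiltonian.\<close>

lemma XX_plus_YY_entry:
  assumes "1 \<le> w" "w < L" "i < 2 ^ L" "j < 2 ^ L" and m: "L - w = Suc m"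
  shows "(site_op L w pauliX * site_op L (w + 1) pauliX
        + site_op L w pauliY * site_op L (w + 1) pauliY) $$ (i, j) =
    (if m \<in> set_decode i \<longleftrightarrow> Suc m \<in> set_decode i then 0
     else 2 * of_bool (set_decode j = sym_diff (set_decode i) {m, Suc m}))"
proof -
  have "set_decode j = sym_diff (set_decode i) {m, Suc m} \<longleftrightarrow>
      set_decode i - {m, Suc m} = set_decode j - {m, Suc m} \<and>
      (m \<in> set_decode i \<longleftrightarrow> m \<notin> set_decode j) \<and> (Suc m \<in> set_decode i \<longleftrightarrow> Suc m \<notin> set_decode j)"
    by (simp only: set_eq_iff) fastforce
  moreover have "(site_op L w pauliX * site_op L (w + 1) pauliX
        + site_op L w pauliY * site_op L (w + 1) pauliY) $$ (i, j) =
      (site_op L w pauliX * site_op L (w + 1) pauliX) $$ (i, j)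
        + (site_op L w pauliY * site_op L (w + 1) pauliY) $$ (i, j)"
    using assms site_op_carrier[OF _ _ pauli_carrier(2), of w L]
      site_op_carrier[OF _ _ pauli_carrier(2), of "w + 1" L]
    by (intro index_add_mat) auto
  ultimately show ?thesis
    unfolding adjacent_site_ops_entry[OF assms(1,2) pauli_carrier(1,1) assms(3,4) m]
      adjacent_site_ops_entry[OF assms(1,2) pauli_carrier(2,2) assms(3,4) m] pauliX_entry pauliY_entry
    by (cases "m \<in> set_decode i"; cases "m \<in> set_decode j";
        cases "Suc m \<in> set_decode i"; cases "Suc m \<in> set_decode j") simp_all
qed

lemma H_XY_entry:
  assumes "i < 2 ^ L" "j < 2 ^ L"
  shows "H_XY L $$ (i, j) = - (\<Sum>m | Suc m < L. if m \<in> set_decode i \<longleftrightarrow> Suc m \<in> set_decode i then 0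
     else of_bool (set_decode j = sym_diff (set_decode i) {m, Suc m}))"
proof -
  let ?h = "\<lambda>m. if m \<in> set_decode i \<longleftrightarrow> Suc m \<in> set_decode i then 0
     else of_bool (set_decode j = sym_diff (set_decode i) {m, Suc m}) :: complex"
  have "H_XY L $$ (i, j) = - (1/2) * (\<Sum>w\<in>{1..<L}. 2 * ?h (L - w - 1))"
  proof -
    have "H_XY L $$ (i, j) = - (1/2) * (\<Sum>w\<in>{1..<L}. (site_op L w pauliX * site_op L (w+1) pauliX
        + site_op L w pauliY * site_op L (w+1) pauliY) $$ (i, j))"
      using assms by (simp only: H_XY_def index_mat case_prod_conv)
    also have "\<dots> = - (1/2) * (\<Sum>w\<in>{1..<L}. 2 * ?h (L - w - 1))"
    proof (intro arg_cong2[where f="(*)"] sum.cong refl)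
      fix w assume "w \<in> {1..<L}"
      then have w: "1 \<le> w" "w < L" "L - w = Suc (L - w - 1)" by auto
      show "(site_op L w pauliX * site_op L (w+1) pauliX
        + site_op L w pauliY * site_op L (w+1) pauliY) $$ (i, j) = 2 * ?h (L - w - 1)"
        unfolding XX_plus_YY_entry[OF w(1,2) assms w(3)] by simp
    qed
    finally show ?thesis .
  qed
  also have "\<dots> = - (\<Sum>w\<in>{1..<L}. ?h (L - w - 1))"
    by (simp flip: sum_distrib_left)
  \<comment> \<open>Qubits \<open>w\<close> and \<open>w + 1\<close> are the sites
    \<open>Suc m\<close> and \<open>m\<close> for \<open>m = L - w - 1\<close>.\<close>
  also have "(\<Sum>w\<in>{1..<L}. ?h (L - w - 1)) = (\<Sum>m | Suc m < L. ?h m)"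
    by (rule sum.reindex_bij_witness[of _ "\<lambda>m. L - m - 1" "\<lambda>w. L - w - 1"]) auto
  finally show ?thesis .
qed

section \<open>The matrix exponential\<close>

text \<open>The sum of all entry moduli dominates every column sum, so each further factor of
  \<open>A\<close> costs at most one factor of it. This makes the exponential series converge
  entrywise.\<close>

lemma pow_mat_entry_bound:
  fixes A :: "complex mat"
  assumes "A \<in> carrier_mat n n" "i < n" "j < n"
  shows "cmod ((A ^\<^sub>m k) $$ (i, j)) \<le> (\<Sum>p\<in>{..<n} \<times> {..<n}. cmod (A $$ p)) ^ k"
  using assms(2,3)
proof (induction k arbitrary: i j)
  case 0
  then show ?case using assms(1) by simp
next
  case (Suc k)
  let ?B = "\<Sum>p\<in>{..<n} \<times> {..<n}. cmod (A $$ p)"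
  have "(A ^\<^sub>m Suc k) $$ (i, j) = (\<Sum>l<n. (A ^\<^sub>m k) $$ (i, l) * A $$ (l, j))"
    using Suc.prems assms(1) by (simp add: scalar_prod_def lessThan_atLeast0)
  then have "cmod ((A ^\<^sub>m Suc k) $$ (i, j)) \<le> (\<Sum>l<n. cmod ((A ^\<^sub>m k) $$ (i, l)) * cmod (A $$ (l, j)))"
    by (simp only: norm_mult[symmetric] norm_sum)
  also have "\<dots> \<le> (\<Sum>l<n. ?B ^ k * cmod (A $$ (l, j)))"
    using Suc by (intro sum_mono mult_right_mono) auto
  also have "\<dots> = ?B ^ k * (\<Sum>p\<in>(\<lambda>l. (l, j)) ` {..<n}. cmod (A $$ p))"
    by (subst sum.reindex) (auto simp: inj_on_def sum_distrib_left)
  also have "\<dots> \<le> ?B ^ k * ?B"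
    using Suc.prems by (intro mult_left_mono sum_mono2) (auto intro!: sum_nonneg zero_le_power)
  finally show ?case by (simp add: mult.commute)
qed

text \<open>Matrix powers append factors on the right, whereas the differential equation for the
  exponential needs the generator on the left.\<close>

lemma pow_mat_Suc_left:
  fixes A :: "complex mat"
  assumes "A \<in> carrier_mat n n"
  shows "A ^\<^sub>m Suc k = A * A ^\<^sub>m k"
proof (induction k)
  case 0
  then show ?case using assms by simp
next
  case (Suc k)
  have "A ^\<^sub>m Suc (Suc k) = (A * A ^\<^sub>m k) * A" using Suc by simp
  also have "\<dots> = A * (A ^\<^sub>m k * A)"
    using assms by (intro assoc_mult_mat[of _ n n _ n _ n]) auto
  finally show ?case by simp
qed

lemma pow_mat_smult:
  fixes A :: "complex mat"
  assumes "A \<in> carrier_mat n n"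
  shows "(c \<cdot>\<^sub>m A) ^\<^sub>m k = c ^ k \<cdot>\<^sub>m A ^\<^sub>m k"
proof (induction k)
  case 0
  then show ?case using assms by (intro eq_matI) auto
next
  case (Suc k)
  have A: "A ^\<^sub>m k \<in> carrier_mat n n" using assms by simp
  have "(c \<cdot>\<^sub>m A) ^\<^sub>m Suc k = (c ^ k \<cdot>\<^sub>m A ^\<^sub>m k) * (c \<cdot>\<^sub>m A)" using Suc by simp
  also have "\<dots> = c \<cdot>\<^sub>m (c ^ k \<cdot>\<^sub>m (A ^\<^sub>m k * A))"
    using mult_smult_distrib[OF smult_carrier_mat[OF A] assms] mult_smult_assoc_mat[OF A assms] by simp
  also have "\<dots> = c ^ Suc k \<cdot>\<^sub>m A ^\<^sub>m Suc k" by (intro eq_matI) auto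
  finally show ?case .
qed

text \<open>Pulling out the scalar turns each entry into an ordinary power series in
  \<open>c\<close>, to which termwise differentiation applies.\<close>

lemma mat_exp_smult_entry:
  fixes A :: "complex mat"
  assumes "A \<in> carrier_mat n n" "i < n" "j < n"
  shows "mat_exp (c \<cdot>\<^sub>m A) $$ (i, j) = (\<Sum>k. (A ^\<^sub>m k) $$ (i, j) / fact k * c ^ k)"
  using assms pow_mat_dim[of A] by (simp add: mat_exp_def pow_mat_smult[OF assms(1)] mult.commute)

lemma mat_exp_summable:
  fixes A :: "complex mat"
  assumes "A \<in> carrier_mat n n" "i < n" "j < n"
  shows "summable (\<lambda>k. (A ^\<^sub>m k) $$ (i, j) / fact k * c ^ k)"
proof -
  let ?B = "\<Sum>p\<in>{..<n} \<times> {..<n}. cmod (A $$ p)"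
  have "norm ((A ^\<^sub>m k) $$ (i, j) / fact k * c ^ k) \<le> inverse (fact k) * (?B * cmod c) ^ k" for k
  proof -
    have "norm ((A ^\<^sub>m k) $$ (i, j) / fact k * c ^ k) =
        inverse (fact k) * (cmod ((A ^\<^sub>m k) $$ (i, j)) * cmod c ^ k)"
      by (simp add: norm_mult norm_divide norm_power field_simps)
    also have "\<dots> \<le> inverse (fact k) * (?B ^ k * cmod c ^ k)"
      by (intro mult_left_mono mult_right_mono pow_mat_entry_bound[OF assms]) auto
    finally show ?thesis by (simp add: power_mult_distrib)
  qed
  then show ?thesis
    by (intro summable_comparison_test[OF _ summable_exp[of "?B * cmod c"]]) blast
qed

text \<open>Differentiation shifts the power series by one, and \<open>pow_mat_Suc_left\<close>
  splits off the extra factor. The variable is complex so that \<open>c\<close> can later be -i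
  times the time.\<close>

lemma mat_exp_has_field_derivative:
  fixes A :: "complex mat"
  assumes "A \<in> carrier_mat n n" "i < n" "j < n"
  shows "((\<lambda>c. mat_exp (c \<cdot>\<^sub>m A) $$ (i, j)) has_field_derivative
    (\<Sum>l<n. A $$ (i, l) * mat_exp (c \<cdot>\<^sub>m A) $$ (l, j))) (at c)"
proof -
  let ?a = "\<lambda>i k. (A ^\<^sub>m k) $$ (i, j) / fact k"
  have "((\<lambda>c. \<Sum>k. ?a i k * c ^ k) has_field_derivative (\<Sum>k. diffs (?a i) k * c ^ k)) (at c)"
    using mat_exp_summable[OF assms] by (rule termdiffs_strong_converges_everywhere)
  moreover have "diffs (?a i) k * c ^ k = (\<Sum>l<n. A $$ (i, l) * (?a l k * c ^ k))" for k
  proof -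
    have "diffs (?a i) k = (A ^\<^sub>m Suc k) $$ (i, j) / fact k"
      by (simp add: diffs_def del: pow_mat.simps of_nat_Suc)
    also have "(A ^\<^sub>m Suc k) $$ (i, j) = (\<Sum>l<n. A $$ (i, l) * (A ^\<^sub>m k) $$ (l, j))"
      unfolding pow_mat_Suc_left[OF assms(1)] using assms by (simp add: scalar_prod_def lessThan_atLeast0)
    finally show ?thesis by (simp add: sum_divide_distrib sum_distrib_right mult.assoc)
  qed
  moreover have "(\<Sum>k. \<Sum>l<n. A $$ (i, l) * (?a l k * c ^ k)) = (\<Sum>l<n. A $$ (i, l) * (\<Sum>k. ?a l k * c ^ k))"
  proof -
    have s: "summable (\<lambda>k. ?a l k * c ^ k)" if "l \<in> {..<n}" for l
      using mat_exp_summable[OF assms(1) _ assms(3)] that by simp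
    have "(\<Sum>k. \<Sum>l<n. A $$ (i, l) * (?a l k * c ^ k)) = (\<Sum>l<n. \<Sum>k. A $$ (i, l) * (?a l k * c ^ k))"
      by (intro suminf_sum summable_mult s)
    also have "\<dots> = (\<Sum>l<n. A $$ (i, l) * (\<Sum>k. ?a l k * c ^ k))"
      by (intro sum.cong refl suminf_mult s)
    finally show ?thesis .
  qed
  ultimately show ?thesis
    using assms by (simp add: mat_exp_smult_entry)
qed

section \<open>Jordan--Wigner modes\<close>

text \<open>The sign is the Jordan--Wigner string; \<open>hopping\<close> below is minus the Hamiltonian.\<close>

definition annihilate :: "nat \<Rightarrow> (nat set \<Rightarrow> complex) \<Rightarrow> nat set \<Rightarrow> complex" where
  "annihilate i f S = (if i \<in> S then 0 else (-1) ^ card (S \<inter> {..<i}) * f (insert i S))"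

definition hop :: "nat \<Rightarrow> (nat set \<Rightarrow> complex) \<Rightarrow> nat set \<Rightarrow> complex" where
  "hop m f S = (if m \<in> S \<longleftrightarrow> Suc m \<in> S then 0 else f (sym_diff S {m, Suc m}))"

definition hopping :: "nat \<Rightarrow> (nat set \<Rightarrow> complex) \<Rightarrow> nat set \<Rightarrow> complex" where
  "hopping L f S = (\<Sum>m | Suc m < L. hop m f S)"

definition inner_config :: "nat \<Rightarrow> (nat set \<Rightarrow> complex) \<Rightarrow> (nat set \<Rightarrow> complex) \<Rightarrow> complex" where
  "inner_config L f g = (\<Sum>S\<in>Pow {..<L}. cnj (f S) * g S)"

lemma finite_bonds [simp]: "finite {m. Suc m < L}"
  by (rule finite_subset[of _ "{..<L}"]) auto

section \<open>Self-adjointness of the hopping operator\<close>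

lemma sum_swap_config:
  assumes "Suc m < L"
  shows "(\<Sum>S\<in>Pow {..<L}. h (sym_diff S {m, Suc m})) = (\<Sum>S\<in>Pow {..<L}. h S)"
proof -
  have "sym_diff (sym_diff S {m, Suc m}) {m, Suc m} = S" for S by auto
  moreover have "sym_diff S {m, Suc m} \<in> Pow {..<L}" if "S \<in> Pow {..<L}" for S
    using that assms by auto
  ultimately show ?thesis
    by (intro sum.reindex_bij_witness[of _ "\<lambda>S. sym_diff S {m, Suc m}" "\<lambda>S. sym_diff S {m, Suc m}"]) simp_all
qed

text \<open>Toggling both ends of the bond is an involution on configurations that preserves the
  condition that exactly one end is occupied. Reindexing by it moves the hop to the other
  argument.\<close>

lemma hop_self_adjoint:
  assumes "Suc m < L"
  shows "inner_config L f (hop m g) = inner_config L (hop m f) g"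
proof -
  have "inner_config L f (hop m g) =
      (\<Sum>S\<in>Pow {..<L}. cnj (f (sym_diff S {m, Suc m})) * hop m g (sym_diff S {m, Suc m}))"
    unfolding inner_config_def using sum_swap_config[OF assms, of "\<lambda>S. cnj (f S) * hop m g S"] by simp
  also have "\<dots> = inner_config L (hop m f) g"
    unfolding inner_config_def
  proof (rule sum.cong[OF refl])
    fix S
    have "sym_diff (sym_diff S {m, Suc m}) {m, Suc m} = S" by auto
    then show "cnj (f (sym_diff S {m, Suc m})) * hop m g (sym_diff S {m, Suc m}) = cnj (hop m f S) * g S"
      by (auto simp: hop_def)
  qed
  finally show ?thesis .
qed

lemma hopping_self_adjoint: "inner_config L f (hopping L g) = inner_config L (hopping L f) g"
proof -
  have "inner_config L f (hopping L g) = (\<Sum>m | Suc m < L. inner_config L f (hop m g))"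
    unfolding inner_config_def hopping_def sum_distrib_left by (rule sum.swap)
  also have "\<dots> = (\<Sum>m | Suc m < L. inner_config L (hop m f) g)"
    by (intro sum.cong) (auto simp: hop_self_adjoint)
  also have "\<dots> = inner_config L (hopping L f) g"
    unfolding inner_config_def hopping_def cnj_sum sum_distrib_right by (rule sum.swap)
  finally show ?thesis .
qed

section \<open>Commutators of annihilators and modes with hopping\<close>

lemma card_below_Suc: "card (S \<inter> {..<Suc m}) = card (S \<inter> {..<m}) + (if m \<in> S then 1 else 0)"
proof -
  have "S \<inter> {..<Suc m} = (if m \<in> S then insert m (S \<inter> {..<m}) else S \<inter> {..<m})"
    by (auto simp: less_Suc_eq)
  then show ?thesis by simp
qed

text \<open>Moving a particle along a bond changes the number below \<open>i\<close> only if the cut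
  falls between the two ends, that is for \<open>i = Suc m\<close>. This is why the Jordan-Wigner
  signs are compatible with nearest-neighbour hops.\<close>

lemma card_below_swap:
  assumes "i \<noteq> Suc m" "m \<in> S \<longleftrightarrow> Suc m \<notin> S"
  shows "card (sym_diff S {m, Suc m} \<inter> {..<i}) = card (S \<inter> {..<i})"
proof (cases "i \<le> m")
  case True
  then have "sym_diff S {m, Suc m} \<inter> {..<i} = S \<inter> {..<i}" by auto
  then show ?thesis by simp
next
  case False
  then have i: "m < i" "Suc m < i" using assms(1) by auto
  let ?R = "(S - {m, Suc m}) \<inter> {..<i}"
  have "S \<inter> {..<i} = insert (if m \<in> S then m else Suc m) ?R"
    "sym_diff S {m, Suc m} \<inter> {..<i} = insert (if m \<in> S then Suc m else m) ?R"
    using i assms(2) by auto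
  then show ?thesis by simp
qed

lemma annihilate_hop_far:
  assumes "i \<noteq> m" "i \<noteq> Suc m"
  shows "annihilate i (hop m f) S = hop m (annihilate i f) S"
proof -
  have "sym_diff (insert i S) {m, Suc m} = insert i (sym_diff S {m, Suc m})"
    using assms by auto
  then show ?thesis
    using card_below_swap[of i m S] assms by (auto simp: annihilate_def hop_def)
qed

text \<open>Both terms on the right can be nonzero together only for \<open>m\<close> occupied and
  \<open>Suc m\<close> empty. There they cancel, because the string of \<open>Suc m\<close> counts
  the particle at \<open>m\<close> in addition.\<close>

lemma annihilate_hop_left:
  "annihilate m (hop m f) S = hop m (annihilate m f) S + annihilate (Suc m) f S"
proof -
  have "sym_diff (insert m S) {m, Suc m} = insert (Suc m) S" if "m \<notin> S" "Suc m \<notin> S"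
    using that by auto
  moreover have "insert m (sym_diff S {m, Suc m}) = insert (Suc m) S" if "m \<in> S" "Suc m \<notin> S"
    using that by auto
  ultimately show ?thesis
    using card_below_swap[of m m S] by (auto simp: annihilate_def hop_def card_below_Suc)
qed

lemma annihilate_hop_right:
  "annihilate (Suc m) (hop m f) S = hop m (annihilate (Suc m) f) S + annihilate m f S"
proof -
  have "sym_diff (insert (Suc m) S) {m, Suc m} = insert m S" if "m \<notin> S" "Suc m \<notin> S"
    using that by auto
  moreover have "insert (Suc m) (sym_diff S {m, Suc m}) = insert m S" if "m \<notin> S" "Suc m \<in> S"
    using that by auto
  ultimately show ?thesis
    using card_below_swap[of m m S]
    by (cases "m \<in> S"; cases "Suc m \<in> S") (simp_all add: annihilate_def hop_def card_below_Suc)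
qed

definition neighbours :: "nat \<Rightarrow> nat \<Rightarrow> nat set" where
  "neighbours L i = {j. j < L \<and> (j = Suc i \<or> i = Suc j)}"

text \<open>Only the bonds touching \<open>i\<close> fail to commute with
  \<open>annihilate i\<close>, and each leaves the annihilator at its other end. The commutator is
  thus linear in the annihilators, which is what makes the fermions free.\<close>

lemma annihilate_hopping:
  assumes "i < L"
  shows "annihilate i (hopping L f) S =
    hopping L (annihilate i f) S + (\<Sum>j\<in>neighbours L i. annihilate j f S)"
proof -
  have *: "annihilate i (hop m f) S = hop m (annihilate i f) S
      + (if m = i then annihilate (Suc i) f S else 0) + (if Suc m = i then annihilate m f S else 0)" for m
    using annihilate_hop_far annihilate_hop_left annihilate_hop_right by auto
  have "annihilate i (hopping L f) S = (\<Sum>m | Suc m < L. annihilate i (hop m f) S)"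
    by (simp add: annihilate_def hopping_def sum_distrib_left)
  also have "\<dots> = hopping L (annihilate i f) S
      + ((\<Sum>m | Suc m < L. if m = i then annihilate (Suc i) f S else 0)
      + (\<Sum>m | Suc m < L. if Suc m = i then annihilate m f S else 0))"
    unfolding * by (simp add: hopping_def sum.distrib)
  also have "(\<Sum>m | Suc m < L. if m = i then annihilate (Suc i) f S else 0)
      = (\<Sum>j | j < L \<and> j = Suc i. annihilate j f S)"
    by (auto intro: sum.mono_neutral_cong_right simp: Collect_conv_if)
  also have "(\<Sum>m | Suc m < L. if Suc m = i then annihilate m f S else 0)
      = (\<Sum>j | j < L \<and> i = Suc j. annihilate j f S)"
    using assms by (subst sum.inter_filter[symmetric]) (auto intro!: sum.cong)
  also have "(\<Sum>j | j < L \<and> j = Suc i. annihilate j f S) + (\<Sum>j | j < L \<and> i = Suc j. annihilate j f S)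
      = (\<Sum>j\<in>neighbours L i. annihilate j f S)"
    unfolding neighbours_def
    by (subst sum.union_disjoint[symmetric]) (auto intro!: sum.cong)
  finally show ?thesis .
qed

definition mode :: "nat \<Rightarrow> (nat \<Rightarrow> real) \<Rightarrow> (nat set \<Rightarrow> complex) \<Rightarrow> nat set \<Rightarrow> complex" where
  "mode L v f S = (\<Sum>i<L. of_real (v i) * annihilate i f S)"

text \<open>Adjacency is symmetric, so the neighbour sum can be moved from the annihilators onto the
  coefficients, where the eigenvector equation turns it into a scalar.\<close>

lemma mode_hopping:
  assumes "\<And>j. j < L \<Longrightarrow> (\<Sum>i\<in>neighbours L j. v i) = \<mu> * v j"
  shows "mode L v (hopping L f) S = hopping L (mode L v f) S + of_real \<mu> * mode L v f S"
proof -
  have "mode L v (hopping L f) S = (\<Sum>i<L. of_real (v i) * hopping L (annihilate i f) S)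
      + (\<Sum>i<L. \<Sum>j\<in>neighbours L i. of_real (v i) * annihilate j f S)"
    by (simp add: mode_def annihilate_hopping sum.distrib sum_distrib_left ring_distribs)
  also have "(\<Sum>i<L. of_real (v i) * hopping L (annihilate i f) S) = hopping L (mode L v f) S"
    unfolding hopping_def mode_def hop_def sum_distrib_left
    by (subst sum.swap) (auto intro!: sum.cong)
  also have "(\<Sum>i<L. \<Sum>j\<in>neighbours L i. of_real (v i) * annihilate j f S)
      = (\<Sum>j<L. \<Sum>i\<in>neighbours L j. of_real (v i) * annihilate j f S)"
  proof -
    have 1: "neighbours L i = {j \<in> {..<L}. j = Suc i \<or> i = Suc j}" for i
      by (auto simp: neighbours_def)
    show ?thesis
      unfolding 1 by (subst sum.swap_restrict) (auto intro!: sum.cong)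
  qed
  also have "\<dots> = (\<Sum>j<L. of_real (\<Sum>i\<in>neighbours L j. v i) * annihilate j f S)"
    by (simp add: sum_distrib_right)
  also have "\<dots> = of_real \<mu> * mode L v f S"
    by (simp add: assms mode_def sum_distrib_left mult.assoc)
  finally show ?thesis .
qed

text \<open>Since \<open>hopping\<close> is minus the Hamiltonian, the first assumption is the
  Schroedinger equation. A mode applied to a solution solves the same equation with its energy
  shifted by the eigenvalue.\<close>

lemma mode_has_vector_derivative:
  assumes "\<And>S. S \<subseteq> {..<L} \<Longrightarrow> ((\<lambda>t. f t S) has_vector_derivative \<i> * hopping L (f t) S) (at t)"
    and "\<And>j. j < L \<Longrightarrow> (\<Sum>i\<in>neighbours L j. v i) = \<mu> * v j"
    and "S \<subseteq> {..<L}"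
  shows "((\<lambda>t. mode L v (f t) S) has_vector_derivative
    \<i> * (hopping L (mode L v (f t)) S + of_real \<mu> * mode L v (f t) S)) (at t)"
proof -
  have "((\<lambda>t. mode L v (f t) S) has_vector_derivative mode L v (\<lambda>S. \<i> * hopping L (f t) S) S) (at t)"
    unfolding mode_def annihilate_def
  proof (intro has_vector_derivative_sum has_vector_derivative_mult_right)
    fix i assume "i \<in> {..<L}"
    then have "insert i S \<subseteq> {..<L}" using assms(3) by simp
    from has_vector_derivative_mult_right[OF assms(1)[OF this]]
    show "((\<lambda>t. if i \<in> S then 0 else (-1) ^ card (S \<inter> {..<i}) * f t (insert i S)) has_vector_derivative
      (if i \<in> S then 0 else (-1) ^ card (S \<inter> {..<i}) * (\<i> * hopping L (f t) (insert i S)))) (at t)"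
      by (cases "i \<in> S") simp_all
  qed
  also have "mode L v (\<lambda>S. \<i> * hopping L (f t) S) S = \<i> * mode L v (hopping L (f t)) S"
    by (simp add: mode_def annihilate_def sum_distrib_left mult_ac if_distrib cong: if_cong)
  finally show ?thesis
    using mode_hopping[OF assms(2)] by simp
qed

section \<open>Evolution of overlaps and the expected particle number\<close>

text \<open>By self-adjointness the two hopping terms cancel in the derivative of the overlap,
  leaving a scalar linear equation with frequency \<open>b - a\<close>.\<close>

lemma inner_config_evolution:
  assumes u: "\<And>S t. S \<subseteq> {..<L} \<Longrightarrow>
      ((\<lambda>t. u t S) has_vector_derivative \<i> * (hopping L (u t) S + of_real a * u t S)) (at t)"
    and v: "\<And>S t. S \<subseteq> {..<L} \<Longrightarrow>
      ((\<lambda>t. v t S) has_vector_derivative \<i> * (hopping L (v t) S + of_real b * v t S)) (at t)"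
  shows "inner_config L (u t) (v t) = cis ((b - a) * t) * inner_config L (u 0) (v 0)"
proof -
  define g where "g t = inner_config L (u t) (v t)" for t
  have g': "(g has_vector_derivative \<i> * of_real (b - a) * g t) (at t)" for t
  proof -
    have "(g has_vector_derivative (\<Sum>S\<in>Pow {..<L}.
        cnj (u t S) * (\<i> * (hopping L (v t) S + of_real b * v t S))
        + cnj (\<i> * (hopping L (u t) S + of_real a * u t S)) * v t S)) (at t)"
      unfolding g_def inner_config_def
      by (intro has_vector_derivative_sum has_vector_derivative_mult
          bounded_linear.has_vector_derivative[OF bounded_linear_cnj] u v) auto
    also have "(\<Sum>S\<in>Pow {..<L}.
        cnj (u t S) * (\<i> * (hopping L (v t) S + of_real b * v t S))
        + cnj (\<i> * (hopping L (u t) S + of_real a * u t S)) * v t S)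
      = \<i> * inner_config L (u t) (hopping L (v t)) - \<i> * inner_config L (hopping L (u t)) (v t)
        + \<i> * of_real (b - a) * g t"
      unfolding g_def inner_config_def sum_distrib_left sum_subtractf[symmetric] sum.distrib[symmetric]
      by (intro sum.cong) (auto simp: algebra_simps)
    finally show ?thesis by (simp add: hopping_self_adjoint)
  qed
  have c': "((\<lambda>t. cis (- ((b - a) * t))) has_vector_derivative - \<i> * of_real (b - a) * cis (- ((b - a) * t))) (at t)" for t
  proof -
    have "((\<lambda>z. exp (- \<i> * of_real (b - a) * z)) has_field_derivative
        - \<i> * of_real (b - a) * exp (- \<i> * of_real (b - a) * of_real t)) (at (of_real t))"
      by (auto intro!: derivative_eq_intros)
    from has_vector_derivative_real_field[OF this] show ?thesis
      by (simp add: cis_conv_exp mult.assoc)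
  qed
  \<comment> \<open>The opposite phase serves as integrating factor.\<close>
  have "((\<lambda>t. cis (- ((b - a) * t)) * g t) has_vector_derivative 0) (at t)" for t
    by (rule has_vector_derivative_eq_rhs[OF has_vector_derivative_mult[OF c' g']]) (simp add: algebra_simps)
  then obtain c where "cis (- ((b - a) * t)) * g t = c" for t
    using has_vector_derivative_zero_constant[of UNIV "\<lambda>t. cis (- ((b - a) * t)) * g t"]
    by (metis UNIV_I convex_UNIV)
  from this[of t] this[of 0] have "cis (- ((b - a) * t)) * g t = g 0" by simp
  then have "cis ((b - a) * t) * (cis (- ((b - a) * t)) * g t) = cis ((b - a) * t) * g 0" by simp
  then show ?thesis
    by (simp add: g_def mult.assoc[symmetric] cis_mult)
qed

lemma inner_config_sum:
  "inner_config L (\<lambda>S. \<Sum>i\<in>A. of_real (x i) * f i S) (\<lambda>S. \<Sum>j\<in>B. of_real (y j) * g j S) =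
    (\<Sum>i\<in>A. \<Sum>j\<in>B. of_real (x i * y j) * inner_config L (f i) (g j))"
proof -
  have "inner_config L (\<lambda>S. \<Sum>i\<in>A. of_real (x i) * f i S) (\<lambda>S. \<Sum>j\<in>B. of_real (y j) * g j S) =
      (\<Sum>S\<in>Pow {..<L}. \<Sum>i\<in>A. \<Sum>j\<in>B. of_real (x i * y j) * (cnj (f i S) * g j S))"
    unfolding inner_config_def cnj_sum sum_product by (simp add: mult_ac)
  also have "\<dots> = (\<Sum>i\<in>A. \<Sum>j\<in>B. \<Sum>S\<in>Pow {..<L}. of_real (x i * y j) * (cnj (f i S) * g j S))"
    by (subst sum.swap, rule sum.cong[OF refl], rule sum.swap)
  finally show ?thesis
    by (simp add: inner_config_def sum_distrib_left)
qed

text \<open>The string signs square to 1, and inserting \<open>i\<close> matches configurations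
  without \<open>i\<close> to those with \<open>i\<close>; the value is the mean occupation of site
  \<open>i\<close>.\<close>

lemma inner_annihilate:
  assumes "i < L"
  shows "inner_config L (annihilate i f) (annihilate i f) =
    of_real (\<Sum>S\<in>Pow {..<L}. if i \<in> S then (cmod (f S))\<^sup>2 else 0)"
proof -
  have "inner_config L (annihilate i f) (annihilate i f) =
      (\<Sum>S | S \<in> Pow {..<L} \<and> i \<notin> S. of_real ((cmod (f (insert i S)))\<^sup>2))"
    unfolding inner_config_def
    by (intro sum.mono_neutral_cong_right)
      (auto simp: annihilate_def complex_norm_square mult_ac simp del: of_real_power simp flip: power_add mult.assoc)
  also have "\<dots> = (\<Sum>S | S \<in> Pow {..<L} \<and> i \<in> S. of_real ((cmod (f S))\<^sup>2))"
    by (rule sum.reindex_bij_witness[of _ "\<lambda>S. S - {i}" "insert i"])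
      (use assms in \<open>auto simp: insert_absorb\<close>)
  also have "\<dots> = of_real (\<Sum>S\<in>Pow {..<L}. if i \<in> S then (cmod (f S))\<^sup>2 else 0)"
    by (subst sum.inter_filter) (simp_all add: if_distrib cong: if_cong)
  finally show ?thesis .
qed

text \<open>Removing a particle from a single configuration leaves a single configuration, and
  different removed sites leave different ones.\<close>

lemma inner_annihilate_config:
  assumes "S\<^sub>0 \<subseteq> {..<L}"
  defines "f \<equiv> \<lambda>S. if S = S\<^sub>0 then 1 else 0"
  shows "inner_config L (annihilate i f) (annihilate j f) = (if i = j \<and> i \<in> S\<^sub>0 then 1 else 0)"
proof -
  have *: "annihilate i f = (\<lambda>S. if i \<in> S\<^sub>0 \<and> S = S\<^sub>0 - {i} then (-1) ^ card (S \<inter> {..<i}) else 0)" for i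
    by (auto simp: annihilate_def f_def fun_eq_iff)
  show ?thesis
  proof (cases "i = j \<and> i \<in> S\<^sub>0")
    case True
    have "inner_config L (annihilate i f) (annihilate i f) =
        (\<Sum>S\<in>Pow {..<L}. if S = S\<^sub>0 - {i} then 1 else 0)"
      unfolding inner_config_def
      by (rule sum.cong) (use True in \<open>auto simp: * simp flip: power_add\<close>)
    moreover have "S\<^sub>0 - {i} \<in> Pow {..<L}" using assms by auto
    ultimately show ?thesis using True by auto
  next
    case False
    then show ?thesis
      unfolding inner_config_def by (intro sum.neutral[THEN trans]) (auto simp: *)
  qed
qed

lemma config_evolution_norm:
  assumes "\<And>S t. S \<subseteq> {..<L} \<Longrightarrow> ((\<lambda>t. f t S) has_vector_derivative \<i> * hopping L (f t) S) (at t)"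
    and "S\<^sub>0 \<subseteq> {..<L}" and "f 0 = (\<lambda>S. if S = S\<^sub>0 then 1 else 0)"
  shows "(\<Sum>S\<in>Pow {..<L}. (cmod (f t S))\<^sup>2) = 1"
proof -
  have "complex_of_real (\<Sum>S\<in>Pow {..<L}. (cmod (f t S))\<^sup>2) = inner_config L (f t) (f t)"
    unfolding inner_config_def of_real_sum complex_norm_square by (simp add: mult.commute)
  also have "\<dots> = inner_config L (f 0) (f 0)"
    using inner_config_evolution[of L f 0 f 0 t] assms(1) by simp
  also have "\<dots> = (\<Sum>S\<in>Pow {..<L}. if S = S\<^sub>0 then 1 else 0)"
    unfolding inner_config_def assms(3) by (intro sum.cong) auto
  also have "\<dots> = 1" using assms(2) by simp
  finally show ?thesis by (simp only: of_real_eq_1_iff)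
qed

text \<open>The occupation of \<open>R\<close> is a sum of squared norms of annihilated states.
  Expanding these in modes reduces the time dependence to pair overlaps, each of which only acquires
  a phase.\<close>

lemma expected_number:
  fixes f :: "real \<Rightarrow> nat set \<Rightarrow> complex" and \<phi> :: "nat \<Rightarrow> nat \<Rightarrow> real"
  assumes f: "\<And>S t. S \<subseteq> {..<L} \<Longrightarrow> ((\<lambda>t. f t S) has_vector_derivative \<i> * hopping L (f t) S) (at t)"
    and R: "R \<subseteq> {..<L}" and f0: "f 0 = (\<lambda>S. if S = {..<L} - R then 1 else 0)"
    and \<phi>: "\<And>k j. k < L \<Longrightarrow> j < L \<Longrightarrow> (\<Sum>i\<in>neighbours L j. \<phi> k i) = \<mu> k * \<phi> k j"
    and orth: "\<And>k l. k < L \<Longrightarrow> l < L \<Longrightarrow> (\<Sum>i<L. \<phi> k i * \<phi> l i) = of_bool (k = l)"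
    and complete: "\<And>i j. i < L \<Longrightarrow> j < L \<Longrightarrow> (\<Sum>k<L. \<phi> k i * \<phi> k j) = of_bool (i = j)"
  defines "A \<equiv> \<lambda>k l. \<Sum>i\<in>R. \<phi> k i * \<phi> l i"
  shows "(\<Sum>S\<in>Pow {..<L}. card (S \<inter> R) * (cmod (f t S))\<^sup>2) =
    (\<Sum>k<L. \<Sum>l<L. A k l * (of_bool (k = l) - A k l) * cos ((\<mu> l - \<mu> k) * t))"
proof -
  have fin: "finite R" using R finite_subset by blast
  \<comment> \<open>At time 0 only the sites outside \<open>R\<close> are filled, so the overlap is
    the sum over the complement of \<open>R\<close>; orthonormality rewrites it as the Kronecker
    delta minus \<open>A k l\<close>.\<close>
  have D: "inner_config L (mode L (\<phi> k) (f t)) (mode L (\<phi> l) (f t)) =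
      cis ((\<mu> l - \<mu> k) * t) * of_real (of_bool (k = l) - A k l)" if "k < L" "l < L" for k l
  proof -
    have "inner_config L (mode L (\<phi> k) (f t)) (mode L (\<phi> l) (f t)) =
        cis ((\<mu> l - \<mu> k) * t) * inner_config L (mode L (\<phi> k) (f 0)) (mode L (\<phi> l) (f 0))"
      by (rule inner_config_evolution) (use that in \<open>auto intro!: mode_has_vector_derivative f \<phi>\<close>)
    also have "inner_config L (mode L (\<phi> k) (f 0)) (mode L (\<phi> l) (f 0)) =
        (\<Sum>i<L. \<Sum>j<L. of_real (\<phi> k i * \<phi> l j) *
          inner_config L (annihilate i (f 0)) (annihilate j (f 0)))"
      unfolding mode_def inner_config_sum ..
    also have "\<dots> = (\<Sum>i<L. \<Sum>j<L. if i = j then of_real (if i \<in> R then 0 else \<phi> k i * \<phi> l i) else 0)"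
      unfolding f0 by (intro sum.cong refl) (subst inner_annihilate_config, auto)
    also have "\<dots> = of_real (\<Sum>i<L. if i \<in> R then 0 else \<phi> k i * \<phi> l i)"
      by simp
    also have "(\<Sum>i<L. if i \<in> R then 0 else \<phi> k i * \<phi> l i) = (\<Sum>i\<in>{..<L} - R. \<phi> k i * \<phi> l i)"
      by (rule sum.mono_neutral_cong_right) auto
    also have "\<dots> = of_bool (k = l) - A k l"
      using sum_diff[OF finite_lessThan R, of "\<lambda>i. \<phi> k i * \<phi> l i"] orth[OF that] by (simp add: A_def)
    finally show ?thesis .
  qed
  \<comment> \<open>Completeness inverts the passage from sites to modes.\<close>
  have expand: "annihilate i (f t) = (\<lambda>S. \<Sum>k<L. of_real (\<phi> k i) * mode L (\<phi> k) (f t) S)" if "i < L" for i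
  proof
    fix S
    have "(\<Sum>k<L. of_real (\<phi> k i) * mode L (\<phi> k) (f t) S) =
        (\<Sum>k<L. \<Sum>j<L. of_real (\<phi> k i * \<phi> k j) * annihilate j (f t) S)"
      by (simp add: mode_def sum_distrib_left mult_ac)
    also have "\<dots> = (\<Sum>j<L. of_real (\<Sum>k<L. \<phi> k i * \<phi> k j) * annihilate j (f t) S)"
      by (subst sum.swap) (simp add: sum_distrib_right)
    also have "\<dots> = (\<Sum>j<L. if i = j then annihilate j (f t) S else 0)"
      by (intro sum.cong) (auto simp: complete that)
    also have "\<dots> = annihilate i (f t) S" using that by simp
    finally show "annihilate i (f t) S = (\<Sum>k<L. of_real (\<phi> k i) * mode L (\<phi> k) (f t) S)" ..
  qed
  have "(\<Sum>S\<in>Pow {..<L}. card (S \<inter> R) * (cmod (f t S))\<^sup>2) =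
      (\<Sum>S\<in>Pow {..<L}. \<Sum>i\<in>R. if i \<in> S then (cmod (f t S))\<^sup>2 else 0)"
    by (intro sum.cong refl)
      (subst sum.inter_filter[symmetric], auto simp: fin Int_def conj_commute)
  also have "\<dots> = (\<Sum>i\<in>R. \<Sum>S\<in>Pow {..<L}. if i \<in> S then (cmod (f t S))\<^sup>2 else 0)"
    by (rule sum.swap)
  finally have "complex_of_real (\<Sum>S\<in>Pow {..<L}. card (S \<inter> R) * (cmod (f t S))\<^sup>2) =
      (\<Sum>i\<in>R. inner_config L (annihilate i (f t)) (annihilate i (f t)))"
    using R by (auto simp: inner_annihilate intro!: sum.cong)
  also have "\<dots> = (\<Sum>i\<in>R. \<Sum>k<L. \<Sum>l<L. of_real (\<phi> k i * \<phi> l i) *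
      inner_config L (mode L (\<phi> k) (f t)) (mode L (\<phi> l) (f t)))"
    using R by (intro sum.cong refl) (auto simp: expand inner_config_sum)
  also have "\<dots> = (\<Sum>k<L. \<Sum>l<L. \<Sum>i\<in>R. of_real (\<phi> k i * \<phi> l i) *
      inner_config L (mode L (\<phi> k) (f t)) (mode L (\<phi> l) (f t)))"
    by (subst sum.swap, rule sum.cong[OF refl], rule sum.swap)
  also have "\<dots> = (\<Sum>k<L. \<Sum>l<L. of_real (A k l) *
      (cis ((\<mu> l - \<mu> k) * t) * of_real (of_bool (k = l) - A k l)))"
    by (intro sum.cong refl) (auto simp: D A_def sum_distrib_right)
  \<comment> \<open>The left side is real, so taking real parts leaves only the cosines of the
    phases.\<close>
  finally have "(\<Sum>S\<in>Pow {..<L}. card (S \<inter> R) * (cmod (f t S))\<^sup>2) =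
      Re (\<Sum>k<L. \<Sum>l<L. of_real (A k l) * (cis ((\<mu> l - \<mu> k) * t) * of_real (of_bool (k = l) - A k l)))"
    by (metis Re_complex_of_real)
  also have "\<dots> = (\<Sum>k<L. \<Sum>l<L. A k l * (of_bool (k = l) - A k l) * cos ((\<mu> l - \<mu> k) * t))"
    by (simp add: mult_ac)
  finally show ?thesis .
qed

section \<open>Spectrum of the path\<close>

text \<open>Sites and modes count from 0, hence the shifts by one. The waves vanish at the two
  phantom sites just beyond the ends of the path, which encodes the open boundary.\<close>

definition sine_mode :: "nat \<Rightarrow> nat \<Rightarrow> nat \<Rightarrow> real" where
  "sine_mode L k i = sqrt (2 / real (L + 1)) * sin (real (k + 1) * real (i + 1) * (pi / real (L + 1)))"

definition chain_eigenvalue :: "nat \<Rightarrow> nat \<Rightarrow> real" where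
  "chain_eigenvalue L k = 2 * cos (real (k + 1) * (pi / real (L + 1)))"

text \<open>This symmetry lets completeness be read off from orthonormality.\<close>

lemma sine_mode_commute: "sine_mode L k i = sine_mode L i k"
  by (simp add: sine_mode_def mult_ac)

text \<open>The addition theorem gives the three-term recurrence for sines. As \<open>s 0\<close>
  and \<open>s (Suc L)\<close> vanish, the end sites with a missing neighbour obey it too.\<close>

lemma sine_mode_eigenvector:
  assumes "j < L"
  shows "(\<Sum>i\<in>neighbours L j. sine_mode L k i) = chain_eigenvalue L k * sine_mode L k j"
proof -
  define x where "x = real (k + 1) * (pi / real (L + 1))"
  define s where "s y = sqrt (2 / real (L + 1)) * sin (real y * x)" for y
  have s: "sine_mode L k i = s (Suc i)" for i
    by (simp add: sine_mode_def s_def x_def mult_ac)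
  have "real (Suc L) * x = real (k + 1) * pi" by (simp add: x_def)
  then have sL: "s (Suc L) = 0" by (simp only: s_def sin_npi mult_zero_right)
  have u: "neighbours L j = {i. i < L \<and> i = Suc j} \<union> {i. i < L \<and> j = Suc i}"
    by (auto simp: neighbours_def)
  have "(\<Sum>i\<in>neighbours L j. s (Suc i)) =
      (\<Sum>i | i < L \<and> i = Suc j. s (Suc i)) + (\<Sum>i | i < L \<and> j = Suc i. s (Suc i))"
    unfolding u by (rule sum.union_disjoint) auto
  also have "(\<Sum>i | i < L \<and> i = Suc j. s (Suc i)) = s (j + 2)"
  proof (cases "Suc j < L")
    case True
    then have "{i. i < L \<and> i = Suc j} = {Suc j}" by auto
    then show ?thesis by simp
  next
    case False
    with assms have "j + 2 = Suc L" "{i. i < L \<and> i = Suc j} = {}" by auto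
    with sL show ?thesis by simp
  qed
  also have "(\<Sum>i | i < L \<and> j = Suc i. s (Suc i)) = s j"
  proof (cases j)
    case 0
    then show ?thesis by (simp add: s_def)
  next
    case (Suc i)
    with assms have "{i. i < L \<and> j = Suc i} = {i}" by auto
    with Suc show ?thesis by simp
  qed
  also have "s (j + 2) + s j = 2 * cos x * s (Suc j)"
  proof -
    have *: "real (j + 2) * x = real (Suc j) * x + x" "real j * x = real (Suc j) * x - x"
      by (simp_all add: algebra_simps)
    show ?thesis
      unfolding s_def * sin_add sin_diff by (simp add: algebra_simps)
  qed
  finally show ?thesis by (simp add: s chain_eigenvalue_def x_def)
qed

text \<open>Multiplied by \<open>2 * sin (x / 2)\<close>, each cosine becomes a difference of
  consecutive sines, so the sum telescopes.\<close>

lemma sin_half_times_sum_cos: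
  fixes x :: real
  shows "2 * sin (x / 2) * (\<Sum>i<K. cos (real (i + 1) * x)) = sin (real K * x + x / 2) - sin (x / 2)"
proof (induction K)
  case (Suc K)
  have "2 * sin (x / 2) * cos (real (K + 1) * x) = sin (real (Suc K) * x + x / 2) - sin (real K * x + x / 2)"
  proof -
    have "real (Suc K) * x + x / 2 = real (K + 1) * x + x / 2" "real K * x + x / 2 = real (K + 1) * x - x / 2"
      by (simp_all add: algebra_simps)
    then show ?thesis by (simp only: sin_add sin_diff) simp
  qed
  with Suc show ?case by (simp add: algebra_simps)
qed simp

lemma sum_cos_multiples:
  fixes x :: real
  assumes "sin (x / 2) \<noteq> 0" "sin (real (L + 1) * x) = 0"
  shows "(\<Sum>i<L. cos (real (i + 1) * x)) = - (cos (real (L + 1) * x) + 1) / 2"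
proof -
  have "real L * x + x / 2 = real (L + 1) * x - x / 2" by (simp add: algebra_simps)
  then have "2 * sin (x / 2) * (\<Sum>i<L. cos (real (i + 1) * x)) =
      - cos (real (L + 1) * x) * sin (x / 2) - sin (x / 2)"
    using assms(2) by (simp only: sin_half_times_sum_cos sin_diff)
  also have "\<dots> = 2 * sin (x / 2) * (- (cos (real (L + 1) * x) + 1) / 2)"
    by (simp add: algebra_simps)
  finally show ?thesis using assms(1) by (simp only: mult_cancel_left) simp
qed

text \<open>The product formula for sines splits each summand into cosines of multiples of
  \<open>x\<close> and \<open>y\<close>. For \<open>k\<close> different from \<open>l\<close> both
  cosine sums have the same value and cancel.\<close>

lemma sine_mode_orthonormal:
  assumes "k < L" "l < L"
  shows "(\<Sum>i<L. sine_mode L k i * sine_mode L l i) = of_bool (k = l)"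
proof -
  define N where "N = real (L + 1)"
  define x where "x = (real k - real l) * (pi / N)"
  define y where "y = real (k + l + 2) * (pi / N)"
  have N: "N > 0" by (simp add: N_def)
  have "sine_mode L k i * sine_mode L l i = (cos (real (i + 1) * x) - cos (real (i + 1) * y)) / N" for i
  proof -
    have "sqrt (2 / N) * sqrt (2 / N) = 2 / N" using N by simp
    then have *: "sqrt (2 / N) * a * (sqrt (2 / N) * b) = 2 / N * (a * b)" for a b
      by (metis mult.assoc mult.left_commute)
    have "sine_mode L k i * sine_mode L l i = 2 / N *
        (sin (real (k + 1) * real (i + 1) * (pi / N)) * sin (real (l + 1) * real (i + 1) * (pi / N)))"
      unfolding sine_mode_def N_def[symmetric] by (rule *)
    also have "\<dots> = 2 / N * ((cos (real (i + 1) * x) - cos (real (i + 1) * y)) / 2)"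
    proof -
      have "real (k + 1) * real (i + 1) * (pi / N) - real (l + 1) * real (i + 1) * (pi / N) = real (i + 1) * x"
        "real (k + 1) * real (i + 1) * (pi / N) + real (l + 1) * real (i + 1) * (pi / N) = real (i + 1) * y"
        using N by (simp_all add: x_def y_def field_simps)
      then show ?thesis by (simp only: sin_times_sin)
    qed
    finally show ?thesis using N by (simp add: field_simps)
  qed
  then have "(\<Sum>i<L. sine_mode L k i * sine_mode L l i) =
      ((\<Sum>i<L. cos (real (i + 1) * x)) - (\<Sum>i<L. cos (real (i + 1) * y))) / N"
    by (simp only: sum_subtractf flip: sum_divide_distrib)
  moreover have Nx: "real (L + 1) * x = real k * pi - real l * pi"
    unfolding N_def[symmetric] x_def using N by (simp add: field_simps)
  moreover have Ny: "real (L + 1) * y = real k * pi + real l * pi + 2 * pi"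
    unfolding N_def[symmetric] y_def using N by (simp add: field_simps)
  moreover have "(\<Sum>i<L. cos (real (i + 1) * y)) = - (cos (real (L + 1) * y) + 1) / 2"
  proof (rule sum_cos_multiples)
    have "real (k + l + 2) < 2 * N" using assms by (simp add: N_def)
    then have "y < 2 * N * (pi / N)" unfolding y_def by (rule mult_strict_right_mono) (simp add: N)
    then have "y < 2 * pi" using N by simp
    moreover have "0 < y" using N by (simp add: y_def)
    ultimately have "0 < y / 2" "y / 2 < pi" by simp_all
    then show "sin (y / 2) \<noteq> 0" using sin_gt_zero by fastforce
    show "sin (real (L + 1) * y) = 0" unfolding Ny by (simp add: sin_add)
  qed
  moreover have "(\<Sum>i<L. cos (real (i + 1) * x)) = - (cos (real (L + 1) * x) + 1) / 2" if "k \<noteq> l"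
  proof (rule sum_cos_multiples)
    have "real k - real l < N" "- N < real k - real l" using assms by (auto simp: N_def)
    then have "x < N * (pi / N)" "- N * (pi / N) < x"
      unfolding x_def using N by (intro mult_strict_right_mono; simp)+
    then have "x < pi" "- pi < x" using N by simp_all
    then have "x / 2 < pi" "- pi < x / 2" by simp_all
    moreover have "x \<noteq> 0" using N that by (simp add: x_def)
    ultimately show "sin (x / 2) \<noteq> 0" using sin_eq_0_pi[of "x / 2"] by auto
    show "sin (real (L + 1) * x) = 0" unfolding Nx by (simp add: sin_diff)
  qed
  \<comment> \<open>Here \<open>x = 0\<close>, where the closed formula would divide by zero. The
    sum is \<open>L = N - 1\<close>, and subtracting the \<open>y\<close> sum, which is -1, gives
    \<open>N\<close>.\<close>
  moreover have "(\<Sum>i<L. cos (real (i + 1) * x)) = N - 1" if "k = l"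
    using that by (simp add: x_def N_def)
  moreover have "cos (real (L + 1) * x) = cos (real k * pi) * cos (real l * pi)"
    unfolding Nx cos_diff by simp
  moreover have "cos (real (L + 1) * y) = cos (real k * pi) * cos (real l * pi)"
    unfolding Ny by (simp add: cos_add)
  moreover have "cos (real l * pi) * cos (real l * pi) = 1"
    using sin_cos_squared_add3[of "real l * pi"] by simp
  ultimately show ?thesis
    using N by (cases "k = l") (simp_all only:, simp_all)
qed

text \<open>Reflecting the path changes a mode at most by a sign, so its squared norm 1 is shared
  equally by the two halves.\<close>

lemma sine_mode_half_norm:
  assumes "k < 2 * n"
  shows "(\<Sum>i\<in>{n..<2*n}. sine_mode (2*n) k i * sine_mode (2*n) k i) = 1 / 2"
proof -
  let ?q = "\<lambda>i. sine_mode (2*n) k i * sine_mode (2*n) k i"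
  have reflect: "?q (2*n - Suc i) = ?q i" if "i < 2*n" for i
  proof -
    have "real (2*n - Suc i + 1) = real (2*n + 1) - real (i + 1)"
      using that by auto
    then have "real (k + 1) * real (2*n - Suc i + 1) * (pi / real (2*n + 1)) =
        real (k + 1) * pi - real (k + 1) * real (i + 1) * (pi / real (2*n + 1))"
      by (simp only:) (simp add: field_simps)
    moreover have s0: "sin (real (k + 1) * pi) = 0" by (rule sin_npi)
    moreover have "(cos (real (k + 1) * pi))\<^sup>2 = 1"
      unfolding cos_squared_eq s0 by simp
    ultimately show ?thesis
      unfolding sine_mode_def power2_eq_square[symmetric] power_mult_distrib
      by (simp only: sin_diff) (simp add: power_mult_distrib)
  qed
  have "(\<Sum>i\<in>{n..<2*n}. ?q i) = (\<Sum>i<n. ?q i)"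
    by (rule sum.reindex_bij_witness[of _ "\<lambda>i. 2*n - Suc i" "\<lambda>i. 2*n - Suc i"]) (auto simp: reflect)
  moreover have "(\<Sum>i<n. ?q i) + (\<Sum>i\<in>{n..<2*n}. ?q i) = (\<Sum>i<2*n. ?q i)"
    by (subst sum.union_disjoint[symmetric]) (auto intro!: sum.cong)
  ultimately show ?thesis using sine_mode_orthonormal[OF assms assms] by simp
qed

section \<open>Lower bound on the spectral gaps\<close>

lemma abs_sin_mult_le: "\<bar>sin (real n * x)\<bar> \<le> real n * \<bar>sin x\<bar>"
proof (induction n)
  case (Suc n)
  have "\<bar>sin (real (Suc n) * x)\<bar> \<le> \<bar>sin (real n * x)\<bar> * \<bar>cos x\<bar> + \<bar>cos (real n * x)\<bar> * \<bar>sin x\<bar>"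
    by (simp add: distrib_right sin_add flip: abs_mult) (metis abs_triangle_ineq add.commute mult.commute)
  also have "\<dots> \<le> \<bar>sin (real n * x)\<bar> * 1 + 1 * \<bar>sin x\<bar>"
    by (intro add_mono mult_mono) auto
  finally show ?case using Suc by (simp add: algebra_simps)
qed simp

text \<open>At the left endpoint \<open>x\<close> one has \<open>sin (N * x) = 1\<close>, so
  \<open>abs_sin_mult_le\<close> gives the bound there. Between \<open>x\<close> and
  \<open>pi - x\<close> the sine is never smaller than at \<open>x\<close>.\<close>

lemma sin_ge_inverse:
  assumes "N > 0" "pi / (2 * real N) \<le> y" "y \<le> pi - pi / (2 * real N)"
  shows "sin y \<ge> 1 / real N"
proof -
  define x where "x = pi / (2 * real N)"
  have x: "0 < x" "x \<le> pi / 2" using assms(1) by (auto simp: x_def field_simps)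
  have "real N * x = pi / 2" using assms(1) by (simp add: x_def)
  then have "sin (real N * x) = 1" by (simp only: sin_pi_half)
  then have "1 \<le> real N * \<bar>sin x\<bar>" using abs_sin_mult_le[of N x] by simp
  moreover have "sin x > 0" using x by (intro sin_gt_zero) auto
  ultimately have Nx: "1 / real N \<le> sin x" using assms(1) by (simp add: field_simps)
  have xy: "x \<le> y" "y \<le> pi - x"
    using assms by (simp_all add: x_def)
  have "sin x \<le> sin y"
  proof (cases "y \<le> pi / 2")
    case True
    then show ?thesis using x xy by (intro sin_monotone_2pi_le) auto
  next
    case False
    have "sin x \<le> sin (pi - y)"
      using False x xy by (intro sin_monotone_2pi_le) auto
    then show ?thesis by simp
  qed
  with Nx show ?thesis by simp
qed

text \<open>The difference of cosines is a product of two sines whose angles are multiples of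
  \<open>pi / (2 * N)\<close> lying between one such unit and \<open>pi\<close> minus one unit. Each
  sine is therefore at least \<open>1 / N\<close>.\<close>

lemma chain_eigenvalue_gap:
  assumes "k < L" "l < L" "k \<noteq> l"
  shows "\<bar>chain_eigenvalue L l - chain_eigenvalue L k\<bar> \<ge> 4 / (real (L + 1))\<^sup>2"
  using assms
proof (induction k l rule: linorder_wlog)
  case (le k l)
  define N where "N = L + 1"
  define \<theta> where "\<theta> = pi / (2 * real N)"
  have N: "N > 0" by (simp add: N_def)
  have \<theta>: "\<theta> > 0" "pi = 2 * real N * \<theta>" using N by (auto simp: \<theta>_def)
  have 1: "sin (real (k + l + 2) * \<theta>) \<ge> 1 / real N"
  proof (rule sin_ge_inverse[OF N]; fold \<theta>_def)
    have "1 * \<theta> \<le> real (k + l + 2) * \<theta>" using \<theta> by (intro mult_right_mono) auto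
    then show "\<theta> \<le> real (k + l + 2) * \<theta>" by simp
    have "real (k + l + 2) * \<theta> \<le> (2 * real N - 1) * \<theta>"
      using \<theta> le by (intro mult_right_mono) (auto simp: N_def)
    then show "real (k + l + 2) * \<theta> \<le> pi - \<theta>" unfolding \<theta>(2) by (simp add: left_diff_distrib)
  qed
  have 2: "sin (real (l - k) * \<theta>) \<ge> 1 / real N"
  proof (rule sin_ge_inverse[OF N]; fold \<theta>_def)
    have "1 * \<theta> \<le> real (l - k) * \<theta>" using \<theta> le by (intro mult_right_mono) auto
    then show "\<theta> \<le> real (l - k) * \<theta>" by simp
    have "real (l - k) * \<theta> \<le> (2 * real N - 1) * \<theta>"
      using \<theta> le by (intro mult_right_mono) (auto simp: N_def)
    then show "real (l - k) * \<theta> \<le> pi - \<theta>" unfolding \<theta>(2) by (simp add: left_diff_distrib)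
  qed
  have "chain_eigenvalue L k - chain_eigenvalue L l = 4 * (sin (real (k + l + 2) * \<theta>) * sin (real (l - k) * \<theta>))"
  proof -
    have e: "(real (k + 1) * (pi / real N) + real (l + 1) * (pi / real N)) / 2 = real (k + l + 2) * \<theta>"
      "(real (l + 1) * (pi / real N) - real (k + 1) * (pi / real N)) / 2 = real (l - k) * \<theta>"
      using N le by (simp_all add: \<theta>_def field_simps of_nat_diff)
    have "chain_eigenvalue L k - chain_eigenvalue L l =
        2 * (cos (real (k + 1) * (pi / real N)) - cos (real (l + 1) * (pi / real N)))"
      by (simp add: chain_eigenvalue_def N_def)
    then show ?thesis unfolding cos_diff_cos e by simp
  qed
  moreover have "1 / real N * (1 / real N) \<le> sin (real (k + l + 2) * \<theta>) * sin (real (l - k) * \<theta>)"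
    using 1 2 N by (intro mult_mono order_trans[OF _ 1]) auto
  ultimately show ?case
    by (auto simp: N_def power2_eq_square field_simps)
next
  case (sym k l)
  then show ?case by (metis abs_minus_commute)
qed

section \<open>The time average\<close>

lemma sum_config_eq_sum_index:
  "(\<Sum>S\<in>Pow {..<L}. g S) = (\<Sum>z<2 ^ L. g (set_decode z))"
  using sum.reindex_bij_betw[OF bij_betw_set_decode] by metis

text \<open>A matrix row has one entry per bond whose ends differ in occupation; this is the bridge
  from the given matrix to \<open>hopping\<close>.\<close>

lemma H_XY_apply:
  assumes "S \<subseteq> {..<L}"
  shows "(\<Sum>j<2 ^ L. H_XY L $$ (set_encode S, j) * f (set_decode j)) = - hopping L f S"
proof -
  have fin: "finite S" using assms finite_subset by blast
  have "(\<Sum>j<2 ^ L. H_XY L $$ (set_encode S, j) * f (set_decode j)) =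
      - (\<Sum>j<2 ^ L. \<Sum>m | Suc m < L. (if m \<in> S \<longleftrightarrow> Suc m \<in> S then 0
        else of_bool (set_decode j = sym_diff S {m, Suc m}) * f (set_decode j)))"
    using set_encode_less_power[OF assms] fin
    by (subst sum_negf[symmetric], intro sum.cong refl)
      (simp add: H_XY_entry sum_distrib_right if_distrib[of "\<lambda>x. x * _"] cong: if_cong)
  also have "\<dots> = - (\<Sum>m | Suc m < L. \<Sum>T\<in>Pow {..<L}. (if m \<in> S \<longleftrightarrow> Suc m \<in> S then 0
        else of_bool (T = sym_diff S {m, Suc m}) * f T))"
    unfolding sum_config_eq_sum_index by (subst sum.swap) (rule refl)
  also have "\<dots> = - hopping L f S"
    unfolding hopping_def hop_def
  proof (intro arg_cong[where f=uminus] sum.cong refl)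
    fix m assume "m \<in> {m. Suc m < L}"
    then have "sym_diff S {m, Suc m} \<in> Pow {..<L}" using assms by auto
    then have "(\<Sum>T\<in>Pow {..<L}. of_bool (T = sym_diff S {m, Suc m}) * f T) = f (sym_diff S {m, Suc m})"
      by (simp only: of_bool_def if_distrib[of "\<lambda>x. x * _"] mult_1 mult_zero_left sum.delta finite_Pow_iff
          finite_lessThan if_True cong: if_cong)
    then show "(\<Sum>T\<in>Pow {..<L}. if m \<in> S \<longleftrightarrow> Suc m \<in> S then 0
        else of_bool (T = sym_diff S {m, Suc m}) * f T) =
        (if m \<in> S \<longleftrightarrow> Suc m \<in> S then 0 else f (sym_diff S {m, Suc m}))"
      by (cases "m \<in> S \<longleftrightarrow> Suc m \<in> S") (simp_all only: if_True if_False simp_thms sum.neutral_const)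
  qed
  finally show ?thesis .
qed

lemma H_XY_carrier: "H_XY L \<in> carrier_mat (2 ^ L) (2 ^ L)"
  by (simp add: H_XY_def)

text \<open>The ones sit on qubits \<open>n + 1\<close> to \<open>2 * n\<close>, which are the sites
  below \<open>n\<close>.\<close>

lemma init_state_eq: "init_state n = unit_vec (2 ^ (2*n)) (set_encode {..<n})"
proof -
  have "basis_index (2*n) (\<lambda>w. if w \<le> n then 0 else 1) = (\<Sum>w\<in>{n+1..2*n}. 2 ^ (2*n - w))"
    unfolding basis_index_def by (rule sum.mono_neutral_cong_right) auto
  also have "\<dots> = set_encode {..<n}"
    unfolding set_encode_def
    by (rule sum.reindex_bij_witness[of _ "\<lambda>m. 2*n - m" "\<lambda>w. 2*n - w"]) auto
  finally show ?thesis by (simp add: init_state_def)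
qed

lemma psi_entry:
  assumes "z < 2 ^ (2*n)"
  shows "psi n t $ z = mat_exp ((- \<i> * of_real t) \<cdot>\<^sub>m H_XY (2*n)) $$ (z, set_encode {..<n})"
proof -
  let ?M = "mat_exp ((- \<i> * of_real t) \<cdot>\<^sub>m H_XY (2*n))"
  have M: "?M \<in> carrier_mat (2 ^ (2*n)) (2 ^ (2*n))"
    using H_XY_carrier[of "2*n"] by (auto simp: mat_exp_def)
  have "set_encode {..<n} < 2 ^ (2*n)" by (rule set_encode_less_power) auto
  then show ?thesis
    unfolding psi_def init_state_eq using M assms
    by (simp add: scalar_prod_right_unit)
qed

text \<open>Vanishing outside the lattice makes the initial amplitude an indicator function on all sets.\<close>

definition amplitude :: "nat \<Rightarrow> real \<Rightarrow> nat set \<Rightarrow> complex" where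
  "amplitude n t S = (if S \<subseteq> {..<2*n} then psi n t $ set_encode S else 0)"

lemma amplitude_decode:
  assumes "z < 2 ^ (2*n)"
  shows "amplitude n t (set_decode z) = psi n t $ z"
  using set_decode_less_power[OF assms] by (simp add: amplitude_def)

lemma amplitude_0: "amplitude n 0 = (\<lambda>S. if S = {..<n} then 1 else 0)"
proof
  fix S
  show "amplitude n 0 S = (if S = {..<n} then 1 else 0)"
  proof (cases "S \<subseteq> {..<2*n}")
    case True
    have n: "{..<n} \<subseteq> {..<2*n}" by auto
    have H: "H_XY (2*n) \<in> carrier_mat (2 ^ (2*n)) (2 ^ (2*n))" by (rule H_XY_carrier)
    note less = set_encode_less_power[OF True] set_encode_less_power[OF n]
    have "amplitude n 0 S = mat_exp (0 \<cdot>\<^sub>m H_XY (2*n)) $$ (set_encode S, set_encode {..<n})"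
      using True psi_entry[OF less(1), of 0] by (simp add: amplitude_def)
    also have "\<dots> = 1\<^sub>m (2 ^ (2*n)) $$ (set_encode S, set_encode {..<n})"
      unfolding mat_exp_smult_entry[OF H less] powser_zero using H by simp
    also have "\<dots> = (if S = {..<n} then 1 else 0)"
      using less set_encode_eq[of S "{..<n}"] finite_subset[OF True] by simp
    finally show ?thesis .
  next
    case False
    then show ?thesis by (auto simp: amplitude_def)
  qed
qed

text \<open>The chain rule contributes -i and the Hamiltonian is minus \<open>hopping\<close>; the
  two signs combine to +i.\<close>

lemma amplitude_has_vector_derivative:
  assumes S: "S \<subseteq> {..<2*n}"
  shows "((\<lambda>t. amplitude n t S) has_vector_derivative \<i> * hopping (2*n) (amplitude n t) S) (at t)"
proof -
  let ?H = "H_XY (2*n)" and ?z = "set_encode S" and ?a = "set_encode {..<n}"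
  have z: "?z < 2 ^ (2*n)" by (rule set_encode_less_power[OF S])
  have z0: "?a < 2 ^ (2*n)" by (rule set_encode_less_power) auto
  let ?D = "\<lambda>c. \<Sum>l<2 ^ (2*n). ?H $$ (?z, l) * mat_exp (c \<cdot>\<^sub>m ?H) $$ (l, ?a)"
  have "((\<lambda>w. mat_exp ((- \<i> * w) \<cdot>\<^sub>m ?H) $$ (?z, ?a)) has_field_derivative
      ?D (- \<i> * of_real t) * (- \<i> * 1)) (at (of_real t))"
    by (intro DERIV_chain2[OF mat_exp_has_field_derivative[OF H_XY_carrier z z0]] DERIV_cmult DERIV_ident)
  from has_vector_derivative_real_field[OF this]
  have "((\<lambda>t. amplitude n t S) has_vector_derivative ?D (- \<i> * of_real t) * (- \<i> * 1)) (at t)"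
    using S by (simp add: amplitude_def psi_entry[OF z])
  also have "?D (- \<i> * of_real t) = (\<Sum>l<2 ^ (2*n). ?H $$ (?z, l) * amplitude n t (set_decode l))"
    by (intro sum.cong refl) (simp add: amplitude_decode psi_entry)
  also have "\<dots> = - hopping (2*n) (amplitude n t) S" by (rule H_XY_apply[OF S])
  finally show ?thesis by (simp add: mult.commute)
qed

section \<open>The event, the mean count and the Markov bound\<close>

lemma Ncount_eq_card: "Ncount n z = card (set_decode z \<inter> {n..<2*n})"
proof -
  have "Ncount n z = (\<Sum>j\<in>{1..n}. of_bool (2*n - j \<in> set_decode z))"
    by (simp add: Ncount_def zbit_def set_decode_def mod_2_eq_odd)
  also have "\<dots> = (\<Sum>m\<in>{n..<2*n}. of_bool (m \<in> set_decode z))"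
    by (rule sum.reindex_bij_witness[of _ "\<lambda>m. 2*n - m" "\<lambda>j. 2*n - j"]) auto
  also have "\<dots> = card (set_decode z \<inter> {n..<2*n})"
    by (simp add: of_bool_def sum.If_cases Int_def conj_commute)
  finally show ?thesis .
qed

lemma prob_event_eq:
  "prob_event n t = (\<Sum>S\<in>Pow {..<2*n}. if real (card (S \<inter> {n..<2*n})) > real n / 4
    then (cmod (amplitude n t S))\<^sup>2 else 0)"
proof -
  have "prob_event n t = (\<Sum>z<2 ^ (2*n). if real (Ncount n z) > real n / 4 then (cmod (psi n t $ z))\<^sup>2 else 0)"
    unfolding prob_event_def by (rule sum.mono_neutral_cong_left) auto
  also have "\<dots> = (\<Sum>S\<in>Pow {..<2*n}. if real (card (S \<inter> {n..<2*n})) > real n / 4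
      then (cmod (amplitude n t S))\<^sup>2 else 0)"
    unfolding sum_config_eq_sum_index
    by (intro sum.cong refl) (simp add: Ncount_eq_card amplitude_decode)
  finally show ?thesis .
qed

definition mean_count :: "nat \<Rightarrow> real \<Rightarrow> real" where
  "mean_count n t = (\<Sum>S\<in>Pow {..<2*n}. card (S \<inter> {n..<2*n}) * (cmod (amplitude n t S))\<^sup>2)"

text \<open>The count is at most \<open>n\<close> on the event and at most \<open>n / 4\<close> off
  it, and the total probability is 1.\<close>

lemma mean_count_le_prob_event: "mean_count n t \<le> 3 / 4 * real n * prob_event n t + real n / 4"
proof -
  let ?p = "\<lambda>S. (cmod (amplitude n t S))\<^sup>2"
  have norm: "(\<Sum>S\<in>Pow {..<2*n}. ?p S) = 1"
    by (rule config_evolution_norm[OF amplitude_has_vector_derivative _ amplitude_0]) auto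
  have "mean_count n t \<le> (\<Sum>S\<in>Pow {..<2*n}. 3 / 4 * real n *
      (if real (card (S \<inter> {n..<2*n})) > real n / 4 then ?p S else 0) + real n / 4 * ?p S)"
    unfolding mean_count_def
  proof (rule sum_mono)
    fix S
    have "card (S \<inter> {n..<2*n}) \<le> card {n..<2*n}" by (rule card_mono) auto
    then have "real (card (S \<inter> {n..<2*n})) \<le> real n" by simp
    then have "card (S \<inter> {n..<2*n}) * ?p S \<le>
        (if real (card (S \<inter> {n..<2*n})) > real n / 4 then real n else real n / 4) * ?p S"
      by (intro mult_right_mono) auto
    then show "card (S \<inter> {n..<2*n}) * ?p S \<le> 3 / 4 * real n *
        (if real (card (S \<inter> {n..<2*n})) > real n / 4 then ?p S else 0) + real n / 4 * ?p S"
      by (auto simp: algebra_simps split: if_splits)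
  qed
  also have "\<dots> = 3 / 4 * real n * prob_event n t + real n / 4"
    unfolding sum.distrib sum_distrib_left[symmetric] norm prob_event_eq by simp
  finally show ?thesis .
qed

text \<open>"Right" refers to large site numbers; these sites form the left half of the
  register.\<close>

definition right_overlap :: "nat \<Rightarrow> nat \<Rightarrow> nat \<Rightarrow> real" where
  "right_overlap n k l = (\<Sum>i\<in>{n..<2*n}. sine_mode (2*n) k i * sine_mode (2*n) l i)"

lemma sine_mode_complete:
  assumes "i < L" "j < L"
  shows "(\<Sum>k<L. sine_mode L k i * sine_mode L k j) = of_bool (i = j)"
  using sine_mode_orthonormal[OF assms] by (simp add: sine_mode_commute[of L i] sine_mode_commute[of L j])

lemma mean_count_expansion:
  "mean_count n t = (\<Sum>k<2*n. \<Sum>l<2*n. right_overlap n k l * (of_bool (k = l) - right_overlap n k l) *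
    cos ((chain_eigenvalue (2*n) l - chain_eigenvalue (2*n) k) * t))"
  unfolding mean_count_def right_overlap_def
proof (rule expected_number)
  have "{..<2*n} - {n..<2*n} = {..<n}" by auto
  then show "amplitude n 0 = (\<lambda>S. if S = {..<2*n} - {n..<2*n} then 1 else 0)"
    by (simp add: amplitude_0)
qed (((rule amplitude_has_vector_derivative sine_mode_eigenvector sine_mode_orthonormal sine_mode_complete; assumption) | force)+)

text \<open>In the mode basis this matrix is the orthogonal projection onto \<open>n\<close> sites,
  so its squared Hilbert-Schmidt norm equals its rank. Completeness is applied in \<open>k\<close>
  and in \<open>l\<close> separately.\<close>

lemma sum_right_overlap_squared: "(\<Sum>k<2*n. \<Sum>l<2*n. (right_overlap n k l)\<^sup>2) = real n"
proof -
  let ?R = "{n..<2*n}" and ?\<phi> = "sine_mode (2*n)"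
  have "(\<Sum>k<2*n. \<Sum>l<2*n. (right_overlap n k l)\<^sup>2) =
      (\<Sum>k<2*n. \<Sum>l<2*n. \<Sum>i\<in>?R. \<Sum>j\<in>?R. (?\<phi> k i * ?\<phi> k j) * (?\<phi> l i * ?\<phi> l j))"
    by (simp add: right_overlap_def power2_eq_square sum_product mult_ac)
  also have "\<dots> = (\<Sum>k<2*n. \<Sum>i\<in>?R. \<Sum>j\<in>?R. \<Sum>l<2*n. (?\<phi> k i * ?\<phi> k j) * (?\<phi> l i * ?\<phi> l j))"
    by (rule sum.cong[OF refl], subst sum.swap, rule sum.cong[OF refl], rule sum.swap)
  also have "\<dots> = (\<Sum>i\<in>?R. \<Sum>j\<in>?R. \<Sum>k<2*n. \<Sum>l<2*n. (?\<phi> k i * ?\<phi> k j) * (?\<phi> l i * ?\<phi> l j))"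
    by (subst sum.swap, rule sum.cong[OF refl], rule sum.swap)
  also have "\<dots> = (\<Sum>i\<in>?R. \<Sum>j\<in>?R. (\<Sum>k<2*n. ?\<phi> k i * ?\<phi> k j) * (\<Sum>l<2*n. ?\<phi> l i * ?\<phi> l j))"
    by (simp only: sum_product)
  also have "\<dots> = (\<Sum>i\<in>?R. \<Sum>j\<in>?R. if i = j then 1 else 0)"
    by (intro sum.cong refl) (auto simp: sine_mode_complete)
  also have "\<dots> = real n" by simp
  finally show ?thesis .
qed

section \<open>Integration over time\<close>

lemma has_integral_cos_mult:
  fixes \<omega> :: real
  assumes "\<omega> \<noteq> 0" "0 \<le> T"
  shows "((\<lambda>t. cos (\<omega> * t)) has_integral sin (\<omega> * T) / \<omega>) {0..T}"
proof -
  have "((\<lambda>t. cos (\<omega> * t)) has_integral sin (\<omega> * T) / \<omega> - sin (\<omega> * 0) / \<omega>) {0..T}"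
    by (rule fundamental_theorem_of_calculus[OF assms(2)])
      (use assms(1) in \<open>auto intro!: derivative_eq_intros simp flip: has_real_derivative_iff_has_vector_derivative\<close>)
  then show ?thesis by simp
qed

lemma mean_count_integral_ge:
  assumes "0 \<le> T"
  obtains I where "(mean_count n has_integral I) {0..T}"
    and "I \<ge> real n / 2 * T - real n * (real (2*n + 1))\<^sup>2 / 4"
proof -
  let ?A = "right_overlap n" and ?\<mu> = "chain_eigenvalue (2*n)" and ?G = "(real (2*n + 1))\<^sup>2 / 4"
  \<comment> \<open>The time integral of each cosine; on the diagonal the frequency is 0 and the
    integrand is 1.\<close>
  define J where "J k l = (if k = l then T else sin ((?\<mu> l - ?\<mu> k) * T) / (?\<mu> l - ?\<mu> k))" for k l
  have gap: "?\<mu> l - ?\<mu> k \<noteq> 0 \<and> 1 / \<bar>?\<mu> l - ?\<mu> k\<bar> \<le> ?G" if "k < 2*n" "l < 2*n" "k \<noteq> l" for k l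
  proof -
    have *: "\<bar>?\<mu> l - ?\<mu> k\<bar> \<ge> 1 / ?G" using chain_eigenvalue_gap[OF that] by simp
    moreover have G: "1 / ?G > 0" by simp
    ultimately have "\<bar>?\<mu> l - ?\<mu> k\<bar> > 0" by linarith
    moreover from this have "1 / \<bar>?\<mu> l - ?\<mu> k\<bar> \<le> 1 / (1 / ?G)"
      using * G by (intro frac_le) auto
    ultimately show ?thesis by simp
  qed
  have J: "((\<lambda>t. cos ((?\<mu> l - ?\<mu> k) * t)) has_integral J k l) {0..T}" if "k < 2*n" "l < 2*n" for k l
    using gap[OF that] has_integral_cos_mult[OF _ assms] has_integral_const_real[of "1 :: real" 0 T] assms
    by (auto simp: J_def)
  have "(mean_count n has_integral (\<Sum>k<2*n. \<Sum>l<2*n. ?A k l * (of_bool (k = l) - ?A k l) * J k l)) {0..T}"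
    unfolding mean_count_expansion[abs_def] by (intro has_integral_sum has_integral_mult_right J) auto
  moreover have "real n / 2 * T - real n * ?G \<le> (\<Sum>k<2*n. \<Sum>l<2*n. ?A k l * (of_bool (k = l) - ?A k l) * J k l)"
  proof -
    \<comment> \<open>The \<open>2 * n\<close> diagonal terms \<open>T / 4\<close> add up to
      \<open>n * T / 2\<close>. The error is subtracted on the diagonal as well, so that the full
      sum of squares, which is \<open>n\<close>, can be inserted.\<close>
    have "real n / 2 * T - real n * ?G = (\<Sum>k<2*n. \<Sum>l<2*n. (if k = l then T / 4 else 0) - (?A k l)\<^sup>2 * ?G)"
      unfolding sum_subtractf sum_distrib_right[symmetric] sum_right_overlap_squared by simp
    also have "\<dots> \<le> (\<Sum>k<2*n. \<Sum>l<2*n. ?A k l * (of_bool (k = l) - ?A k l) * J k l)"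
    proof (intro sum_mono)
      fix k l assume kl: "k \<in> {..<2*n}" "l \<in> {..<2*n}"
      show "(if k = l then T / 4 else 0) - (?A k l)\<^sup>2 * ?G \<le> ?A k l * (of_bool (k = l) - ?A k l) * J k l"
      proof (cases "k = l")
        case True
        have half: "?A l l = 1 / 2" using sine_mode_half_norm kl by (simp add: right_overlap_def)
        show ?thesis unfolding J_def True half by (simp add: power2_eq_square)
      next
        case False
        have "J k l \<le> \<bar>J k l\<bar>" by simp
        also have "\<dots> \<le> 1 / \<bar>?\<mu> l - ?\<mu> k\<bar>"
          using False by (simp add: J_def abs_divide divide_right_mono)
        also have "\<dots> \<le> ?G" using gap kl False by simp
        finally have "(?A k l)\<^sup>2 * J k l \<le> (?A k l)\<^sup>2 * ?G" by (intro mult_left_mono) auto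
        then show ?thesis using False by (simp add: power2_eq_square)
      qed
    qed
    finally show ?thesis .
  qed
  ultimately show ?thesis using that by simp
qed

text \<open>Supplies integrability, without which \<open>integral\<close> would only return a
  default value.\<close>

lemma prob_event_continuous: "continuous_on {0..T} (prob_event n)"
proof -
  have "continuous_on {0..T} (\<lambda>t. amplitude n t S)" if "S \<in> Pow {..<2*n}" for S
    using amplitude_has_vector_derivative[of S n] that
    by (intro continuous_at_imp_continuous_on ballI) (auto intro: has_vector_derivative_continuous)
  then have "continuous_on {0..T} (\<lambda>t. if b then (cmod (amplitude n t S))\<^sup>2 else 0)"
    if "S \<in> Pow {..<2*n}" for S b
    using that by (cases b) (auto intro!: continuous_intros)
  then show ?thesis
    unfolding prob_event_eq[abs_def] by (intro continuous_on_sum)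
qed

text \<open>Integrating the Markov bound and inserting the lower bound for the mean count leaves a
  common factor \<open>n\<close>, which cancels.\<close>

lemma prob_event_integral_ge:
  assumes "0 \<le> T" "n > 0"
  shows "integral {0..T} (prob_event n) \<ge> (T - (real (2*n + 1))\<^sup>2) / 3"
proof -
  obtain I where I: "(mean_count n has_integral I) {0..T}"
    "I \<ge> real n / 2 * T - real n * (real (2*n + 1))\<^sup>2 / 4"
    using mean_count_integral_ge[OF assms(1)] .
  have "(prob_event n has_integral integral {0..T} (prob_event n)) {0..T}"
    using integrable_continuous_real[OF prob_event_continuous] by (rule integrable_integral)
  then have "((\<lambda>t. 3 / 4 * real n * prob_event n t + real n / 4) has_integral
      3 / 4 * real n * integral {0..T} (prob_event n) + T * (real n / 4)) {0..T}"
    using has_integral_const_real[of "real n / 4" 0 T] assms(1)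
    by (intro has_integral_add has_integral_mult_right) auto
  then have "I \<le> 3 / 4 * real n * integral {0..T} (prob_event n) + T * (real n / 4)"
    by (rule has_integral_le[OF I(1)]) (rule mean_count_le_prob_event)
  with I(2) have "real n * ((T - (real (2*n + 1))\<^sup>2) / 3) \<le> real n * integral {0..T} (prob_event n)"
    by (simp add: field_simps)
  then show ?thesis using assms(2) by simp
qed

theorem theorem3:
  shows "\<exists>c C::real. c > 0 \<and> C > 0 \<and>
    (\<forall>n::nat. n > 0 \<and> 4 dvd n \<longrightarrow>
      (let T = c * real n ^ 3 in
        (1 / T) * integral {0..T} (\<lambda>t. prob_event n t) \<ge> 1/4 - C / sqrt (real n)))"
proof (rule exI[of _ 36], rule exI[of _ 1], intro conjI allI impI)
  fix n :: nat assume n: "n > 0 \<and> 4 dvd n"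
  \<comment> \<open>The factor 36 makes \<open>(2 * n + 1)^2\<close>, which is at most
    \<open>9 * n^2\<close>, no larger than \<open>T / 4\<close>; then
    \<open>(T - T / 4) / 3 = T / 4\<close>. The average thus already reaches 1/4, and the choice
    \<open>C = 1\<close> is merely a convenient positive value.\<close>
  define T where "T = 36 * real n ^ 3"
  have T: "T > 0" using n by (simp add: T_def)
  have "(real (2*n + 1))\<^sup>2 \<le> (3 * real n)\<^sup>2" using n by (intro power_mono) auto
  also have "\<dots> \<le> T / 4"
    using n power_increasing[of 2 3 "real n"] by (simp add: T_def power_mult_distrib)
  finally have "T * (1 / 4) \<le> (T - (real (2*n + 1))\<^sup>2) / 3" by simp
  also have "\<dots> \<le> integral {0..T} (prob_event n)"
    using T n by (intro prob_event_integral_ge) auto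
  finally have "1 / 4 \<le> 1 / T * integral {0..T} (prob_event n)"
    using T by (simp add: field_simps)
  moreover have "1 / 4 - 1 / sqrt (real n) \<le> 1 / 4" by simp
  ultimately show "let T = 36 * real n ^ 3 in
      1 / T * integral {0..T} (\<lambda>t. prob_event n t) \<ge> 1/4 - 1 / sqrt (real n)"
    unfolding Let_def T_def by linarith
qed simp_all

end
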